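(* Let $f:\mathbb{R}^n\to\overline{\mathbb{R}}$ be proper and lower semicontinuous and let $L>0$. Then the following are equivalent: (i) $f$ has the anisotropic descent property relative to $\phi$ with constant $L$; (ii) $f\in\mathcal{C}^1(\mathbb{R}^n)$ with $\operatorname{rge}\nabla f\subseteq\operatorname{rge}\nabla\phi$, and $f=\xi\,\square\,(L^{-1}\star\phi)$ for some $\xi:\mathbb{R}^n\to\overline{\mathbb{R}}$. Either of these statements implies that the infimal convolution in (ii) can be taken to be exact for some proper lower semicontinuous $\xi:\mathbb{R}^n\to\overline{\mathbb{R}}$, i.e., for every $x\in\mathbb{R}^n$ there is $y\in\mathbb{R}^n$ such that $(\xi\,\square\,(L^{-1}\star\phi))(x)=(L^{-1}\star\phi)(x-y)+\xi(y)$. If, in addition, $f$ is convex, then the assumption $f\in\mathcal{C}^1(\mathbb{R}^n)$ is superfluous in (ii) (i.e., (ii) may be replaced by: $\operatorname{rge}\partial f\subseteq\operatorname{rge}\nabla\phi$ and $f=\xi\,\square\,(L^{-1}\star\phi)$ for some $\xi:\mathbb{R}^n\to\overline{\mathbb{R}}$), $\xi$ can be taken to be convex and lower semicontinuous, and the following are also equivalent to (i) and (ii): (iii) $f^*=\psi+L^{-1}\phi^*$ for some $\psi\in\Gamma_0(\mathbb{R}^n)$ with $\operatorname{dom}\psi\cap\operatorname{int}\operatorname{dom}\phi^*\neq\emptyset$; (iv) $\operatorname{dom}f^*\subseteq\operatorname{dom}\phi^*$, $\operatorname{ri}\operatorname{dom}f^*\cap\operatorname{int}\operatorname{dom}\phi^*\neq\emptyset$,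 and $f^*-L^{-1}\phi^*$ is convex on $\operatorname{ri}\operatorname{dom}f^*$. If, furthermore, $f$ and $\phi$ are Legendre and $\mathcal{C}^2(\mathbb{R}^n)$ with nonsingular Hessian, then the following is also equivalent to (i)-(iv): (v) $\operatorname{rge}\nabla f\subseteq\operatorname{rge}\nabla\phi$ and $\nabla^2f(x)\preceq L\,\nabla^2\phi(\nabla\phi^*(\nabla f(x)))$ for all $x\in\mathbb{R}^n$.
   Context: $\overline{\mathbb{R}}=\mathbb{R}\cup\{-\infty,+\infty\}$; $\Gamma_0(\mathbb{R}^n)$ is the set of proper lower semicontinuous convex functions $\mathbb{R}^n\to\overline{\mathbb{R}}$; $h^*$ denotes the convex conjugate; $\operatorname{rge}$ denotes the range; $\operatorname{ri}$ the relative interior; $\partial f$ the convex subdifferential. A function in $\Gamma_0(\mathbb{R}^n)$ is Legendre if it is essentially smooth and essentially strictly convex (in the sense of Rockafellar). Standing assumption: the reference function $\phi\in\Gamma_0(\mathbb{R}^n)$ is Legendre with $\operatorname{dom}\phi=\mathbb{R}^n$. Consequently $\nabla\phi:\mathbb{R}^n\to\operatorname{int}\operatorname{dom}\phi^*$ is a bijection with inverse $\nabla\phi^*$. For $\lambda>0$ the epi-scaling is $(\lambda\star h)(x)=\lambda h(\lambda^{-1}x)$. The infimal convolution is $(\xi\,\square\,h)(x)=\inf_{y\in\mathbb{R}^n}\{h(x-y)+\xi(y)\}$. Anisotropic descent property: $f$ has the anisotropic descent property (is anisotropically smooth) relative to $\phi$ with constant $L>0$ if $f\in\mathcal{C}^1(\mathbb{R}^n)$,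 $\operatorname{rge}\nabla f\subseteq\operatorname{rge}\nabla\phi$, and for all $\bar x,x\in\mathbb{R}^n$ $$f(x)\le f(\bar x)+\tfrac1L\star\phi\big(x-\bar x+L^{-1}\nabla\phi^*(\nabla f(\bar x))\big)-\tfrac1L\star\phi\big(L^{-1}\nabla\phi^*(\nabla f(\bar x))\big).$$ *)

theory Defs
  imports "HOL-Analysis.Analysis"
begin

definition dom_fun :: "('a \<Rightarrow> ereal) \<Rightarrow> 'a set" where
  "dom_fun h = {x. h x < \<infinity>}"

definition proper_fun :: "('a \<Rightarrow> ereal) \<Rightarrow> bool" where
  "proper_fun h \<longleftrightarrow> (\<forall>x. h x \<noteq> -\<infinity>) \<and> (\<exists>x. h x \<noteq> \<infinity>)"

definition lsc_fun :: "('a::topological_space \<Rightarrow> ereal) \<Rightarrow> bool" where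
  "lsc_fun h \<longleftrightarrow> (\<forall>x. h x \<le> Liminf (at x) h)"

text \<open>Convexity of an extended-real-valued function is convexity of its epigraph, so that no
  convention for \<open>\<infinity> - \<infinity>\<close> is involved.\<close>

definition convex_fun :: "('a::real_vector \<Rightarrow> ereal) \<Rightarrow> bool" where
  "convex_fun h \<longleftrightarrow> convex {(x, r::real). h x \<le> ereal r}"

definition Gamma0 :: "('a::euclidean_space \<Rightarrow> ereal) set" where
  "Gamma0 = {h. proper_fun h \<and> lsc_fun h \<and> convex_fun h}"

definition conjugate :: "('a::euclidean_space \<Rightarrow> ereal) \<Rightarrow> 'a \<Rightarrow> ereal" where
  "conjugate h v = (SUP x. ereal (v \<bullet> x) - h x)"

definition subdifferential :: "('a::euclidean_space \<Rightarrow> ereal) \<Rightarrow> 'a \<Rightarrow> 'a set" where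
  "subdifferential h x = {v. \<forall>y. h x + ereal (v \<bullet> (y - x)) \<le> h y}"

text \<open>Since \<^const>\<open>real_of_ereal\<close> maps \<open>\<plusminus>\<infinity>\<close> to \<open>0\<close>, differentiability at a point explicitly
  requires finiteness in a neighbourhood.\<close>

definition has_gradient :: "('a::euclidean_space \<Rightarrow> ereal) \<Rightarrow> 'a \<Rightarrow> 'a \<Rightarrow> bool" where
  "has_gradient h g x \<longleftrightarrow>
     (\<forall>\<^sub>F y in nhds x. \<bar>h y\<bar> \<noteq> \<infinity>) \<and> GDERIV (\<lambda>y. real_of_ereal (h y)) x :> g"

definition grad :: "('a::euclidean_space \<Rightarrow> ereal) \<Rightarrow> 'a \<Rightarrow> 'a" where
  "grad h x = (THE g. has_gradient h g x)"

definition C1_fun :: "('a::euclidean_space \<Rightarrow> ereal) \<Rightarrow> bool" where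
  "C1_fun h \<longleftrightarrow> (\<forall>x. \<exists>g. has_gradient h g x) \<and> continuous_on UNIV (grad h)"

definition hessian :: "(real ^ 'n \<Rightarrow> ereal) \<Rightarrow> real ^ 'n \<Rightarrow> real ^ 'n ^ 'n" where
  "hessian h x = jacobian (grad h) (at x)"

definition C2_fun :: "(real ^ 'n \<Rightarrow> ereal) \<Rightarrow> bool" where
  "C2_fun h \<longleftrightarrow>
     C1_fun h \<and> (\<forall>x. grad h differentiable (at x)) \<and> continuous_on UNIV (hessian h)"

definition loewner_le :: "real ^ 'n ^ 'n \<Rightarrow> real ^ 'n ^ 'n \<Rightarrow> bool" where
  "loewner_le A B \<longleftrightarrow> (\<forall>v. 0 \<le> v \<bullet> ((B - A) *v v))"

definition strictly_convex_on :: "'a::real_vector set \<Rightarrow> ('a \<Rightarrow> ereal) \<Rightarrow> bool" where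
  "strictly_convex_on S h \<longleftrightarrow>
     (\<forall>x\<in>S. \<forall>y\<in>S. \<forall>t. x \<noteq> y \<and> 0 < t \<and> t < 1 \<longrightarrow>
        h ((1 - t) *\<^sub>R x + t *\<^sub>R y) < ereal (1 - t) * h x + ereal t * h y)"

text \<open>The next two notions are those of Rockafellar, Convex Analysis, Section 26.\<close>

definition essentially_smooth :: "('a::euclidean_space \<Rightarrow> ereal) \<Rightarrow> bool" where
  "essentially_smooth h \<longleftrightarrow>
     interior (dom_fun h) \<noteq> {} \<and>
     (\<forall>x\<in>interior (dom_fun h). \<exists>g. has_gradient h g x) \<and>
     (\<forall>x z. range x \<subseteq> interior (dom_fun h) \<and> x \<longlonglongrightarrow> z \<and> z \<in> frontier (interior (dom_fun h)) \<longrightarrow>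
        filterlim (\<lambda>k. norm (grad h (x k))) at_top sequentially)"

definition essentially_strictly_convex :: "('a::euclidean_space \<Rightarrow> ereal) \<Rightarrow> bool" where
  "essentially_strictly_convex h \<longleftrightarrow>
     (\<forall>S. convex S \<and> S \<subseteq> {x. subdifferential h x \<noteq> {}} \<longrightarrow> strictly_convex_on S h)"

definition Legendre_fun :: "('a::euclidean_space \<Rightarrow> ereal) \<Rightarrow> bool" where
  "Legendre_fun h \<longleftrightarrow> h \<in> Gamma0 \<and> essentially_smooth h \<and> essentially_strictly_convex h"

definition epi_scale :: "real \<Rightarrow> ('a::euclidean_space \<Rightarrow> ereal) \<Rightarrow> 'a \<Rightarrow> ereal" where
  "epi_scale c h x = ereal c * h (x /\<^sub>R c)"

text \<open>On \<^typ>\<open>ereal\<close> one has \<open>\<infinity> + (-\<infinity>) = \<infinity>\<close>, the usual convention for infimal convolution;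
  it is never invoked when \<open>h\<close> is real-valued.\<close>

definition inf_conv :: "('a::euclidean_space \<Rightarrow> ereal) \<Rightarrow> ('a \<Rightarrow> ereal) \<Rightarrow> 'a \<Rightarrow> ereal" where
  "inf_conv \<xi> h x = (INF y. h (x - y) + \<xi> y)"

definition exact_inf_conv :: "('a::euclidean_space \<Rightarrow> ereal) \<Rightarrow> ('a \<Rightarrow> ereal) \<Rightarrow> bool" where
  "exact_inf_conv \<xi> h \<longleftrightarrow> (\<forall>x. \<exists>y. inf_conv \<xi> h x = h (x - y) + \<xi> y)"

definition anisotropic_descent ::
    "('a::euclidean_space \<Rightarrow> ereal) \<Rightarrow> real \<Rightarrow> ('a \<Rightarrow> ereal) \<Rightarrow> bool" where
  "anisotropic_descent \<phi> L f \<longleftrightarrow>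
     C1_fun f \<and> range (grad f) \<subseteq> range (grad \<phi>) \<and>
     (\<forall>xb x. f x \<le> f xb
        + epi_scale (1 / L) \<phi> (x - xb + (1 / L) *\<^sub>R grad (conjugate \<phi>) (grad f xb))
        - epi_scale (1 / L) \<phi> ((1 / L) *\<^sub>R grad (conjugate \<phi>) (grad f xb)))"

end

theory Submission
  imports Defs
begin

text \<open>
  Replacing \<open>\<phi>\<close> by its epi-scaling \<open>p\<close> with factor \<open>1 / L\<close> reduces everything to the constant one.  Write \<open>G\<close> for
  the gradient of \<open>p\<close>, and call \<open>x \<mapsto> F xb + p (x - xb + z) - p z\<close> the model of \<open>F\<close> at \<open>xb\<close>, where \<open>G z\<close> is
  the gradient (or a subgradient) of \<open>F\<close> at \<open>xb\<close>.  Up to an additive constant the model is a translate of \<open>p\<close>, so descent means that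
  at each of its points the graph of \<open>F\<close> is touched from above by a translate of \<open>p\<close>.

  \<^emph>\<open>Infimal convolutions.\<close>  If all these models lie above \<open>F\<close>, then \<open>F\<close> is their exact infimum, and the
  function \<open>\<xi> y = (SUP x. F x - p (x - y))\<close> records the constants (\<open>deconv_exact\<close>).  Conversely, if \<open>F\<close> is an infimum
  of translates of \<open>p\<close>, the models arise as limits of almost optimal translates.  The limit exists because
  almost optimal means almost critical in finite dimension, and because \<open>G\<close> is, by invariance of domain, a
  homeomorphism onto an open set that contains the gradients of \<open>F\<close> (\<open>model_at_differentiable_minorant\<close>).
  For convex \<open>F\<close> the same argument works with an affine minorant instead of \<open>F\<close>, and then \<open>F\<close>, squeezed between an
  affine function and a smooth model, turns out to be differentiable.

  \<^emph>\<open>Conjugates.\<close>  For convex \<open>f\<close>, conjugation turns the convolution into a sum, so the difference of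
  the conjugates is the conjugate of \<open>\<xi>\<close> and therefore convex.  From convexity of that difference one returns to descent directly: the
  model lies above \<open>f\<close> as soon as its conjugate lies below that of \<open>f\<close> (Fenchel--Moreau, \<open>Gamma0_le_if_conjugate_ge\<close>), and this
  says that the difference of conjugates lies above its tangent at the gradient.  That tangent exists
  because subgradients of \<open>f\<close> cannot lie on the boundary of the domain of the conjugate of \<open>p\<close>, where that conjugate
  has infinite slope (\<open>bounded_slope_imp_range\<close>).

  \<^emph>\<open>Hessians.\<close>  Descent makes the model minus \<open>F\<close> minimal at \<open>xb\<close>, whence the inequality of
  second derivatives.  Conversely, inverting positive definite matrices reverses their order, so the difference of
  the conjugates has a positive semidefinite second derivative on the range of the gradient of \<open>F\<close>, which is convex, and lies
  above its tangents there (\<open>hessian_le_imp_descends\<close>).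
\<close>

section \<open>Differentiable convex functions\<close>

lemma GDERIV_line_derivative:
  fixes p :: "'a::euclidean_space \<Rightarrow> real"
  assumes "GDERIV p (x + t *\<^sub>R d) :> g"
  shows "((\<lambda>t. p (x + t *\<^sub>R d)) has_real_derivative (d \<bullet> g)) (at t)"
proof -
  have "((\<lambda>t. x + t *\<^sub>R d) has_derivative (\<lambda>s. s *\<^sub>R d)) (at t)"
    by (auto intro!: derivative_eq_intros)
  moreover have "(p has_derivative (\<lambda>h. h \<bullet> g)) (at (x + t *\<^sub>R d))"
    using assms unfolding gderiv_def .
  ultimately have "((\<lambda>t. p (x + t *\<^sub>R d)) has_derivative (\<lambda>s. (s *\<^sub>R d) \<bullet> g)) (at t)"
    by (rule has_derivative_compose)
  then show ?thesis
    unfolding has_field_derivative_def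
    by (rule has_derivative_eq_rhs) (simp add: fun_eq_iff)
qed

lemma GDERIV_expansion:
  fixes p :: "'a::euclidean_space \<Rightarrow> real"
  shows "GDERIV p x :> g \<longleftrightarrow>
    (\<forall>e>0. \<exists>d>0. \<forall>y. norm (y - x) < d \<longrightarrow> \<bar>p y - p x - g \<bullet> (y - x)\<bar> \<le> e * norm (y - x))"
  unfolding gderiv_def has_derivative_at_alt
  by (auto simp: inner_commute bounded_linear_inner_left)

lemma GDERIV_continuous:
  fixes p :: "'a::euclidean_space \<Rightarrow> real"
  shows "GDERIV p x :> g \<Longrightarrow> isCont p x"
  unfolding gderiv_def by (rule has_derivative_continuous)

lemma GDERIV_inner: "GDERIV (\<lambda>x. v \<bullet> x) x :> v"
  unfolding gderiv_def by (auto intro!: derivative_eq_intros simp: inner_commute)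

lemma GDERIV_affine:
  fixes a :: "'a::euclidean_space"
  assumes "GDERIV p (L *\<^sub>R x + a) :> g"
  shows "GDERIV (\<lambda>x. p (L *\<^sub>R x + a)) x :> L *\<^sub>R g"
proof -
  have "((\<lambda>x. L *\<^sub>R x + a) has_derivative (\<lambda>h. L *\<^sub>R h)) (at x)"
    by (auto intro!: derivative_eq_intros)
  then have "((\<lambda>x. p (L *\<^sub>R x + a)) has_derivative (\<lambda>h. (L *\<^sub>R h) \<bullet> g)) (at x)"
    using assms has_derivative_compose unfolding gderiv_def by blast
  then show ?thesis unfolding gderiv_def by simp
qed

lemma GDERIV_unique:
  fixes p :: "'a::euclidean_space \<Rightarrow> real"
  assumes "GDERIV p x :> g" "GDERIV p x :> g'"
  shows "g = g'"
proof -
  have "(\<lambda>h. h \<bullet> g) = (\<lambda>h. h \<bullet> g')"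
    using assms has_derivative_unique unfolding gderiv_def by blast
  then show ?thesis by (metis inner_commute vector_eq_ldot)
qed

lemma GDERIV_at_minimum:
  fixes p :: "'a::euclidean_space \<Rightarrow> real"
  assumes "GDERIV p x :> g" "0 < r" "\<And>y. y \<in> ball x r \<Longrightarrow> p x \<le> p y"
  shows "g = 0"
proof -
  have "(\<lambda>h. h \<bullet> g) = (\<lambda>h. 0)"
    by (rule differential_zero_maxmin[of x "ball x r" p])
      (use assms in \<open>auto simp: gderiv_def\<close>)
  then show ?thesis by (metis inner_eq_zero_iff)
qed

lemma GDERIV_touching:
  fixes p q :: "'a::euclidean_space \<Rightarrow> real"
  assumes "GDERIV p x :> g" "GDERIV q x :> g'" "\<And>y. p y \<le> q y" "p x = q x"
  shows "g = g'"
proof -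
  have "GDERIV (\<lambda>y. q y - p y) x :> g' - g" using assms by (intro GDERIV_diff)
  then have "g' - g = 0" by (rule GDERIV_at_minimum[where r=1]) (use assms in auto)
  then show ?thesis by simp
qed

lemma GDERIV_sandwich:
  fixes p l u :: "'a::euclidean_space \<Rightarrow> real"
  assumes l: "GDERIV l x :> g" and u: "GDERIV u x :> g"
    and le: "\<And>y. l y \<le> p y" "\<And>y. p y \<le> u y" and eq: "l x = p x" "u x = p x"
  shows "GDERIV p x :> g"
  unfolding GDERIV_expansion
proof (intro allI impI)
  fix e :: real assume "e > 0"
  then obtain d1 d2 where d: "d1 > 0" "d2 > 0"
    "\<And>y. norm (y - x) < d1 \<Longrightarrow> \<bar>l y - l x - g \<bullet> (y - x)\<bar> \<le> e * norm (y - x)"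
    "\<And>y. norm (y - x) < d2 \<Longrightarrow> \<bar>u y - u x - g \<bullet> (y - x)\<bar> \<le> e * norm (y - x)"
    using l u unfolding GDERIV_expansion by metis
  show "\<exists>d>0. \<forall>y. norm (y - x) < d \<longrightarrow> \<bar>p y - p x - g \<bullet> (y - x)\<bar> \<le> e * norm (y - x)"
  proof (intro exI[of _ "min d1 d2"] conjI allI impI)
    fix y assume "norm (y - x) < min d1 d2"
    then show "\<bar>p y - p x - g \<bullet> (y - x)\<bar> \<le> e * norm (y - x)"
      using d(3)[of y] d(4)[of y] le[of y] eq by auto
  qed (use d in auto)
qed

lemma convex_gradient_inequality:
  fixes p :: "'a::euclidean_space \<Rightarrow> real"
  assumes "convex_on UNIV p" "GDERIV p x :> g"
  shows "p x + g \<bullet> (y - x) \<le> p y"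
proof -
  define h where "h t = p (x + t *\<^sub>R (y - x))" for t
  have "(h has_real_derivative ((y - x) \<bullet> g)) (at 0)"
    unfolding h_def by (rule GDERIV_line_derivative) (use assms in simp)
  moreover have "convex_on UNIV h"
  proof (rule convex_onI)
    fix t u v :: real assume "0 < t" "t < 1"
    then show "h ((1 - t) *\<^sub>R u + t *\<^sub>R v) \<le> (1 - t) * h u + t * h v"
      using convex_onD[OF assms(1), of t "x + u *\<^sub>R (y - x)" "x + v *\<^sub>R (y - x)"]
      by (simp add: h_def algebra_simps)
  qed simp
  ultimately have "h 1 - h 0 \<ge> ((y - x) \<bullet> g) * (1 - 0)"
    by (intro convex_on_imp_above_tangent[where A=UNIV]) auto
  then show ?thesis by (simp add: h_def inner_commute)
qed

text \<open>Test the gradient inequality at \<open>y\<close> in the direction of \<open>G y - G x\<close> with a step as long as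
\<open>y - x\<close>: then \<open>G y - G x\<close> is controlled by the errors of the first-order expansion at \<open>x\<close>, taken at two
points whose distance from \<open>x\<close> is at most twice that of \<open>y\<close>.\<close>

lemma convex_gradient_continuous:
  fixes p :: "'a::euclidean_space \<Rightarrow> real"
  assumes cv: "convex_on UNIV p" and G: "\<And>x. GDERIV p x :> G x"
  shows "continuous_on UNIV G"
  unfolding continuous_on_iff
proof (intro ballI allI impI)
  fix x :: 'a and e :: real assume e: "e > 0"
  then have "0 < e / 4" by simp
  then obtain d where d: "d > 0"
    "\<And>y. norm (y - x) < d \<Longrightarrow> \<bar>p y - p x - G x \<bullet> (y - x)\<bar> \<le> (e/4) * norm (y - x)"
    using G[of x, unfolded GDERIV_expansion] by blast
  have "dist (G y) (G x) < e" if y: "dist y x < d / 2" for y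
  proof (cases "y = x")
    case False
    define r where "r = norm (y - x)"
    have r: "0 < r" "2 * r < d" using False y by (auto simp: r_def dist_norm)
    define h where "h = r *\<^sub>R sgn (G y - G x)"
    have nh: "norm h \<le> r" using r by (auto simp: h_def norm_sgn)
    have n: "norm (y + h - x) \<le> 2 * r"
      using norm_triangle_ineq[of "y - x" h] nh by (simp add: r_def algebra_simps)
    have "r * norm (G y - G x) = (G y - G x) \<bullet> h"
      using r by (cases "G y = G x")
        (simp_all add: h_def sgn_div_norm dot_square_norm power2_eq_square)
    also have "\<dots> \<le> p (y + h) - p y - G x \<bullet> h"
      using convex_gradient_inequality[OF cv G, of y "y + h"] by (simp add: inner_diff_left)
    also have "\<dots> = (p (y + h) - p x - G x \<bullet> (y + h - x)) - (p y - p x - G x \<bullet> (y - x))"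
      by (simp add: inner_diff_right inner_add_right)
    also have "\<dots> \<le> (e/4) * norm (y + h - x) + (e/4) * norm (y - x)"
    proof -
      have "norm (y + h - x) < d" "norm (y - x) < d" using n r by (simp_all flip: r_def)
      then show ?thesis using d(2)[of "y + h"] d(2)[of y] by linarith
    qed
    also have "\<dots> \<le> (e/4) * (2 * r) + (e/4) * r"
      using n e by (intro add_mono mult_left_mono) (auto simp: r_def)
    finally have "r * norm (G y - G x) \<le> r * (3/4 * e)" by (simp add: algebra_simps)
    then have "norm (G y - G x) \<le> 3/4 * e" using r by simp
    then show ?thesis using e by (simp add: dist_norm)
  qed (use e in simp)
  then show "\<exists>d>0. \<forall>x'\<in>UNIV. dist x' x < d \<longrightarrow> dist (G x') (G x) < e"
    using d(1) by (intro exI[of _ "d/2"]) auto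
qed

text \<open>A hyperplane separating the translated strict epigraph from the origin yields a subgradient: it
cannot be vertical, because \<open>p\<close> is finite everywhere.\<close>

lemma convex_subgradient_exists:
  fixes p :: "'a::euclidean_space \<Rightarrow> real"
  assumes cv: "convex_on UNIV p"
  shows "\<exists>v. \<forall>y. p x + v \<bullet> (y - x) \<le> p y"
proof -
  define S where "S = {(h, r). p (x + h) < p x + r}"
  have "convex S"
    unfolding convex_alt
  proof (safe)
    fix h k :: 'a and r s t :: real
    assume S: "(h, r) \<in> S" "(k, s) \<in> S" and t: "0 \<le> t" "t \<le> 1"
    have "p (x + ((1 - t) *\<^sub>R h + t *\<^sub>R k)) = p ((1 - t) *\<^sub>R (x + h) + t *\<^sub>R (x + k))"
      by (simp add: algebra_simps)
    also have "\<dots> \<le> (1 - t) * p (x + h) + t * p (x + k)"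
      using cv t by (intro convex_onD) auto
    also have "\<dots> < (1 - t) * (p x + r) + t * (p x + s)"
    proof (cases "t = 0")
      case False
      then show ?thesis using S t
        by (intro add_le_less_mono mult_left_mono mult_strict_left_mono) (auto simp: S_def)
    qed (use S in \<open>auto simp: S_def\<close>)
    finally show "(1 - t) *\<^sub>R (h, r) + t *\<^sub>R (k, s) \<in> S"
      by (simp add: S_def algebra_simps)
  qed
  moreover have "0 \<notin> S" by (simp add: S_def zero_prod_def)
  ultimately obtain ab where "ab \<noteq> 0" and ab: "\<forall>z\<in>S. 0 \<le> ab \<bullet> z"
    using separating_hyperplane_set_0 by blast
  obtain a b where abeq: "ab = (a, b)" by fastforce
  have sep: "0 \<le> a \<bullet> h + b * r" if "p (x + h) < p x + r" for h r
    using ab that by (auto simp: S_def abeq)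
  have "b \<ge> 0" using sep[of 0 1] by simp
  have "b \<noteq> 0"
  proof
    assume "b = 0"
    then have "0 \<le> a \<bullet> (- a)" using sep[of "- a" "p (x - a) - p x + 1"] by simp
    then have "a = 0" by (metis inner_gt_zero_iff inner_minus_right neg_0_le_iff_le not_le)
    then show False using \<open>ab \<noteq> 0\<close> \<open>b = 0\<close> by (simp add: abeq zero_prod_def)
  qed
  then have b: "b > 0" using \<open>b \<ge> 0\<close> by simp
  have "p x + (- a /\<^sub>R b) \<bullet> (y - x) \<le> p y" for y
  proof (rule field_le_epsilon)
    fix e :: real assume "e > 0"
    then have "0 \<le> a \<bullet> (y - x) + b * (p y - p x + e)" by (intro sep) auto
    then have "0 \<le> (a \<bullet> (y - x) + b * (p y - p x + e)) / b" using b by simp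
    then show "p x + (- a /\<^sub>R b) \<bullet> (y - x) \<le> p y + e"
      using b by (simp add: field_simps)
  qed
  then show ?thesis by blast
qed

text \<open>A finite-dimensional substitute for Ekeland's variational principle.  On the sphere of radius \<open>r\<close> the
function \<open>g + 2 \<parallel>\<cdot> - x\<parallel>\<^sup>2\<close> exceeds its value at the centre, so its minimum over the ball lies inside and
there the gradient of \<open>g\<close> equals that of the penalty up to sign.\<close>

lemma almost_minimizer_near_almost_critical:
  fixes g :: "'a::euclidean_space \<Rightarrow> real"
  assumes g: "\<And>y. GDERIV g y :> dg y" and pos: "\<And>y. 0 \<le> g y" and r: "0 < r" "g x \<le> r\<^sup>2"
  shows "\<exists>y. norm (y - x) \<le> r \<and> norm (dg y) \<le> 4 * r"
proof -
  define h where "h y = g y + 2 * ((y - x) \<bullet> (y - x))" for y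
  have dh: "GDERIV h y :> dg y + 4 *\<^sub>R (y - x)" for y
  proof -
    have "((\<lambda>y. 2 * ((y - x) \<bullet> (y - x))) has_derivative (\<lambda>h. h \<bullet> (4 *\<^sub>R (y - x)))) (at y)"
      by (auto intro!: derivative_eq_intros simp: inner_commute algebra_simps)
    then show ?thesis
      unfolding h_def using g[of y] by (intro GDERIV_add) (auto simp: gderiv_def)
  qed
  have "continuous_on (cball x r) h"
    using GDERIV_continuous[OF dh] continuous_at_imp_continuous_on by blast
  then obtain y where y: "y \<in> cball x r" "\<forall>z\<in>cball x r. h y \<le> h z"
    using continuous_attains_inf[of "cball x r" h] r by auto
  have "h y \<le> r\<^sup>2" using y(2) r by (auto simp: h_def dest: bspec[of _ _ x])
  then have "2 * (norm (y - x))\<^sup>2 \<le> r\<^sup>2"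
    using pos[of y] by (simp add: h_def power2_norm_eq_inner)
  moreover have "r\<^sup>2 > 0" using r by simp
  ultimately have "(norm (y - x))\<^sup>2 < r\<^sup>2" by linarith
  then have lt: "norm (y - x) < r" using r by (simp add: power_less_imp_less_base)
  have "dg y + 4 *\<^sub>R (y - x) = 0"
  proof (rule GDERIV_at_minimum[OF dh])
    show "0 < r - norm (y - x)" using lt by simp
    fix z assume "z \<in> ball y (r - norm (y - x))"
    then have "dist x z \<le> r" using dist_triangle[of x z y] by (simp add: dist_norm norm_minus_commute)
    then show "h y \<le> h z" using y by auto
  qed
  then have "dg y = - (4 *\<^sub>R (y - x))" by (simp add: eq_neg_iff_add_eq_0)
  then have "norm (dg y) = 4 * norm (y - x)" by simp
  then show ?thesis using lt by (intro exI[of _ y]) auto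
qed

section \<open>Closed convex functions and conjugation\<close>

lemma lsc_fun_iff_closed_epigraph:
  "lsc_fun h \<longleftrightarrow> closed {(x, r::real). h x \<le> ereal r}"
proof
  assume lsc: "lsc_fun h"
  show "closed {(x, r::real). h x \<le> ereal r}"
    unfolding closed_def
  proof (subst open_subopen, rule ballI)
    fix z assume "z \<in> - {(x, r). h x \<le> ereal r}"
    then obtain x r where z: "z = (x, r)" and r: "ereal r < h x" by (cases z) auto
    obtain c where c: "ereal r < ereal c" "ereal c < h x" using ereal_dense2[OF r] by blast
    have "ereal c < Liminf (at x) h" using lsc c(2) unfolding lsc_fun_def by (meson less_le_trans)
    then have "\<forall>\<^sub>F y in at x. ereal c < h y" by (rule less_LiminfD)
    then have "\<forall>\<^sub>F y in nhds x. ereal c < h y"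
      using c(2) by (auto simp: eventually_at_filter elim: eventually_mono)
    then obtain U where U: "open U" "x \<in> U" "\<And>y. y \<in> U \<Longrightarrow> ereal c < h y"
      unfolding eventually_nhds by blast
    have "\<not> h y \<le> ereal s" if "y \<in> U" "s < c" for y s
      using U(3)[OF that(1)] that(2) less_le_trans[of "ereal c" "h y" "ereal s"] by auto
    then have "U \<times> {..<c} \<subseteq> - {(x, r). h x \<le> ereal r}" by auto
    moreover have "open (U \<times> {..<c})" using U by (intro open_Times) auto
    moreover have "z \<in> U \<times> {..<c}" using U c z by auto
    ultimately show "\<exists>T. open T \<and> z \<in> T \<and> T \<subseteq> - {(x, r). h x \<le> ereal r}" by blast
  qed
next
  assume cl: "closed {(x, r::real). h x \<le> ereal r}"
  show "lsc_fun h"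
    unfolding lsc_fun_def le_Liminf_iff
  proof (intro allI impI)
    fix x y assume "y < h x"
    then obtain c where c: "y < ereal c" "ereal c < h x" using ereal_dense2 by blast
    then have "(x, c) \<in> - {(x, r). h x \<le> ereal r}" by auto
    from open_prod_elim[OF cl[unfolded closed_def] this]
    obtain A B where AB: "open A" "open B" "(x, c) \<in> A \<times> B"
      "A \<times> B \<subseteq> - {(x, r). h x \<le> ereal r}"
      by metis
    have "y < h z" if "z \<in> A" for z
    proof -
      have "(z, c) \<in> - {(x, r). h x \<le> ereal r}" using AB that by blast
      then have "ereal c < h z" by simp
      with c(1) show ?thesis by (rule less_trans)
    qed
    then show "\<forall>\<^sub>F z in at x. y < h z"
      using AB by (auto simp: eventually_at_filter eventually_nhds)
  qed
qed

lemma convex_funD: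
  assumes "convex_fun h" "h x \<le> ereal r" "h y \<le> ereal s" "0 \<le> t" "t \<le> 1"
  shows "h ((1 - t) *\<^sub>R x + t *\<^sub>R y) \<le> ereal ((1 - t) * r + t * s)"
proof -
  have "(1 - t) *\<^sub>R (x, r) + t *\<^sub>R (y, s) \<in> {(x, r). h x \<le> ereal r}"
    using assms by (intro convexD) (auto simp: convex_fun_def)
  then show ?thesis by simp
qed

lemma convex_funI:
  assumes "\<And>x y r s t. \<lbrakk>h x \<le> ereal r; h y \<le> ereal s; 0 \<le> t; t \<le> 1\<rbrakk>
    \<Longrightarrow> h ((1 - t) *\<^sub>R x + t *\<^sub>R y) \<le> ereal ((1 - t) * r + t * s)"
  shows "convex_fun h"
  unfolding convex_fun_def convex_alt using assms by auto

lemma convex_fun_real_iff: "convex_fun (\<lambda>x. ereal (F x)) \<longleftrightarrow> convex_on UNIV F"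
proof
  assume "convex_fun (\<lambda>x. ereal (F x))"
  then show "convex_on UNIV F"
    using convex_funD[of "\<lambda>x. ereal (F x)" x "F x" y "F y" for x y]
    by (intro convex_onI) auto
next
  assume cv: "convex_on UNIV F"
  show "convex_fun (\<lambda>x. ereal (F x))"
  proof (rule convex_funI)
    fix x y :: 'a and r s t :: real
    assume "ereal (F x) \<le> ereal r" "ereal (F y) \<le> ereal s" "0 \<le> t" "t \<le> 1"
    then have "F ((1 - t) *\<^sub>R x + t *\<^sub>R y) \<le> (1 - t) * F x + t * F y"
      "(1 - t) * F x + t * F y \<le> (1 - t) * r + t * s"
      using cv by (auto intro!: convex_onD add_mono mult_left_mono)
    then show "ereal (F ((1 - t) *\<^sub>R x + t *\<^sub>R y)) \<le> ereal ((1 - t) * r + t * s)" by simp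
  qed
qed

lemma convex_dom_fun:
  fixes h :: "'a::real_vector \<Rightarrow> ereal"
  assumes "convex_fun h"
  shows "convex (dom_fun h)"
  unfolding convex_alt
proof (intro ballI allI impI)
  fix x y :: 'a and t :: real
  assume "x \<in> dom_fun h" "y \<in> dom_fun h" and t: "0 \<le> t \<and> t \<le> 1"
  then obtain r s where "h x < ereal r" "h y < ereal s"
    unfolding dom_fun_def using ereal_dense2 by blast
  then have "h ((1 - t) *\<^sub>R x + t *\<^sub>R y) \<le> ereal ((1 - t) * r + t * s)"
    using t by (intro convex_funD[OF assms]) auto
  then show "(1 - t) *\<^sub>R x + t *\<^sub>R y \<in> dom_fun h"
    unfolding dom_fun_def using le_less_trans by fastforce
qed

lemma conjugate_le_iff:
  "conjugate h v \<le> ereal c \<longleftrightarrow> (\<forall>x. ereal (v \<bullet> x - c) \<le> h x)"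
proof -
  have "ereal (v \<bullet> x) - h x \<le> ereal c \<longleftrightarrow> ereal (v \<bullet> x - c) \<le> h x" for x
    by (cases "h x") auto
  then show ?thesis unfolding conjugate_def by (simp add: SUP_le_iff)
qed

lemma conjugate_ge: "h x \<le> ereal r \<Longrightarrow> ereal (v \<bullet> x - r) \<le> conjugate h v"
  unfolding conjugate_def by (rule SUP_upper2[of x]) (cases "h x"; auto)+

text \<open>Each section is a half-space, everything or empty; this is what makes conjugates convex and lower
semicontinuous.\<close>

lemma conjugate_epigraph_sections:
  "{(v, c). conjugate h v \<le> ereal c} = (\<Inter>x. {(v, c). ereal (v \<bullet> x - c) \<le> h x})"
  by (auto simp: conjugate_le_iff)

lemma convex_fun_conjugate: "convex_fun (conjugate h)"
  unfolding convex_fun_def conjugate_epigraph_sections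
proof (rule convex_INT)
  fix x
  show "convex {(v, c). ereal (v \<bullet> x - c) \<le> h x}"
  proof (cases "h x")
    case (real r)
    have "{(v, c). ereal (v \<bullet> x - c) \<le> h x} = {z. (x, -1) \<bullet> z \<le> r}"
      using real by (auto simp: inner_commute)
    then show ?thesis by (simp add: convex_halfspace_le)
  qed auto
qed

lemma lsc_fun_conjugate: "lsc_fun (conjugate h)"
  unfolding lsc_fun_iff_closed_epigraph conjugate_epigraph_sections
proof (rule closed_INT, rule ballI)
  fix x
  show "closed {(v, c). ereal (v \<bullet> x - c) \<le> h x}"
  proof (cases "h x")
    case (real r)
    have "{(v, c). ereal (v \<bullet> x - c) \<le> h x} = {z. (x, -1) \<bullet> z \<le> r}"
      using real by (auto simp: inner_commute)
    then show ?thesis by (simp add: closed_halfspace_le)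
  qed auto
qed

lemma conjugate_gt_MInf: "h x \<noteq> \<infinity> \<Longrightarrow> conjugate h v \<noteq> -\<infinity>"
proof (cases "h x")
  case (real r)
  then show ?thesis using conjugate_ge[of h x r v] by auto
next
  case MInf
  then show ?thesis using conjugate_ge[of h x 0 v] by auto
qed auto

lemma subgradient_conjugate:
  assumes "v \<in> subdifferential f x" "f x = ereal r"
  shows "conjugate f v = ereal (v \<bullet> x - r)"
proof (rule antisym)
  show "conjugate f v \<le> ereal (v \<bullet> x - r)"
    using assms by (auto simp: conjugate_le_iff subdifferential_def inner_diff_right algebra_simps)
  show "ereal (v \<bullet> x - r) \<le> conjugate f v" using assms by (intro conjugate_ge) auto
qed

lemma subgradient_conjugate_le:
  assumes "v \<in> subdifferential f x" "f x = ereal r"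
  shows "ereal (v \<bullet> x - r + (u - v) \<bullet> x) \<le> conjugate f u"
  using conjugate_ge[of f x r u] assms(2) by (simp add: inner_diff_left)

text \<open>The projection of a point below the graph onto the epigraph comes with a normal vector.  If it is
not horizontal, it is a subgradient at the projection, whose affine minorant lies above the point; a
horizontal normal separates \<open>x0\<close> from the domain.\<close>

lemma epigraph_projection:
  fixes f :: "'a::euclidean_space \<Rightarrow> ereal"
  assumes f: "f \<in> Gamma0" and lt: "ereal r0 < f x0"
  obtains (subgradient) x v r where "f x = ereal r" "v \<in> subdifferential f x" "r0 < r + v \<bullet> (x0 - x)"
  | (horizontal) d c where "f x0 = \<infinity>" "\<And>x. x \<in> dom_fun f \<Longrightarrow> d \<bullet> x \<le> c" "c < d \<bullet> x0"
proof -
  let ?E = "{(x, r::real). f x \<le> ereal r}"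
  have cE: "convex ?E" "closed ?E"
    using f by (auto simp: Gamma0_def convex_fun_def lsc_fun_iff_closed_epigraph)
  have nMI: "f x \<noteq> -\<infinity>" for x using f by (auto simp: Gamma0_def proper_fun_def)
  obtain x' where "f x' \<noteq> \<infinity>" using f by (auto simp: Gamma0_def proper_fun_def)
  then obtain r' where "f x' = ereal r'" using nMI by (cases "f x'") auto
  then have "(x', r') \<in> ?E" by simp
  then have ne: "?E \<noteq> {}" by blast
  obtain x1 r1 where cp: "closest_point ?E (x0, r0) = (x1, r1)" by fastforce
  have in1: "f x1 \<le> ereal r1"
    using closest_point_in_set[OF cE(2) ne, of "(x0, r0)"] cp by simp
  have nrm: "(x0 - x1) \<bullet> (x - x1) + (r0 - r1) * (r - r1) \<le> 0" if "f x \<le> ereal r" for x r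
    using closest_point_dot[OF cE, of "(x, r)" "(x0, r0)"] that cp by simp
  have "r0 \<le> r1"
  proof -
    have "f x1 \<le> ereal (r1 + 1)" using in1 by (meson order.trans ereal_less_eq(3) less_eq_real_def less_add_one)
    from nrm[OF this] show ?thesis by simp
  qed
  show ?thesis
  proof (cases "r0 = r1")
    case True
    have fin: "f x0 = \<infinity>"
    proof (rule ccontr)
      assume "f x0 \<noteq> \<infinity>"
      then obtain r where "f x0 = ereal r" using nMI by (cases "f x0") auto
      then have "(x0 - x1) \<bullet> (x0 - x1) \<le> 0" using nrm[of x0 r] True by simp
      then have "x0 = x1" by (metis inner_gt_zero_iff not_le right_minus_eq)
      then show False using in1 lt True by auto
    qed
    have "x0 \<noteq> x1" using in1 lt True by auto
    then have pos: "0 < (x0 - x1) \<bullet> (x0 - x1)" by simp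
    show ?thesis
    proof (rule horizontal[OF fin, of "x0 - x1" "(x0 - x1) \<bullet> x1"])
      fix x assume "x \<in> dom_fun f"
      then obtain r where "f x = ereal r" using nMI by (cases "f x") (auto simp: dom_fun_def)
      then show "(x0 - x1) \<bullet> x \<le> (x0 - x1) \<bullet> x1"
        using nrm[of x r] True by (simp add: inner_diff_right)
    qed (use pos in \<open>simp add: inner_diff_right\<close>)
  next
    case False
    then have s: "0 < r1 - r0" using \<open>r0 \<le> r1\<close> by simp
    define v where "v = (x0 - x1) /\<^sub>R (r1 - r0)"
    have sv: "(x0 - x1) = (r1 - r0) *\<^sub>R v" using s by (simp add: v_def)
    have sub: "r1 + v \<bullet> (x - x1) \<le> r" if "f x \<le> ereal r" for x r
    proof -
      have "(r1 - r0) * (v \<bullet> (x - x1) - (r - r1)) \<le> 0"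
        using nrm[OF that] unfolding sv by (simp add: algebra_simps)
      then show ?thesis using s by (simp add: mult_le_0_iff)
    qed
    obtain r2 where r2: "f x1 = ereal r2" "r2 \<le> r1" using in1 nMI by (cases "f x1") auto
    have "r1 \<le> r2" using sub[of x1 r2] r2 by simp
    then have fx1: "f x1 = ereal r1" using r2 by simp
    have "v \<in> subdifferential f x1"
      unfolding subdifferential_def
    proof (clarsimp simp: fx1)
      fix y show "ereal (r1 + v \<bullet> (y - x1)) \<le> f y"
        using sub[of y] nMI[of y] by (cases "f y") auto
    qed
    moreover have "r0 < r1 + v \<bullet> (x0 - x1)"
    proof -
      have "0 \<le> (r1 - r0) * (v \<bullet> v)" using s by simp
      then show ?thesis unfolding sv inner_scaleR_right using s by linarith
    qed
    ultimately show ?thesis using subgradient fx1 by blast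
  qed
qed

lemma Gamma0_subgradient_exists:
  fixes f :: "'a::euclidean_space \<Rightarrow> ereal"
  assumes f: "f \<in> Gamma0"
  obtains x v r where "f x = ereal r" "v \<in> subdifferential f x"
proof -
  obtain x0 where "f x0 \<noteq> \<infinity>" "f x0 \<noteq> -\<infinity>" using f by (auto simp: Gamma0_def proper_fun_def)
  then obtain r0 where r0: "f x0 = ereal r0" by (cases "f x0") auto
  then have "ereal (r0 - 1) < f x0" by simp
  from f this show ?thesis
    by (cases rule: epigraph_projection) (use r0 that in auto)
qed

text \<open>The Fenchel--Moreau theorem, read as separation by affine functions.  If the projection gives only a
horizontal normal, a large multiple of it is added to some affine minorant: on the domain
this keeps a minorant, and at \<open>x0\<close> it raises the value as much as desired.\<close>

lemma affine_minorant_above: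
  fixes f :: "'a::euclidean_space \<Rightarrow> ereal"
  assumes f: "f \<in> Gamma0" and lt: "ereal r0 < f x0"
  obtains v c where "\<And>x. ereal (v \<bullet> x - c) \<le> f x" "r0 < v \<bullet> x0 - c"
  using f lt
proof (cases rule: epigraph_projection)
  case (subgradient x v r)
  show ?thesis
  proof (rule that[of v "v \<bullet> x - r"])
    fix y show "ereal (v \<bullet> y - (v \<bullet> x - r)) \<le> f y"
      using subgradient(1,2) by (auto simp: subdifferential_def inner_diff_right algebra_simps)
  qed (use subgradient in \<open>simp add: inner_diff_right\<close>)
next
  case (horizontal d c)
  obtain x1 u r1 where u: "f x1 = ereal r1" "u \<in> subdifferential f x1"
    using Gamma0_subgradient_exists[OF f] by blast
  define m where "m y = r1 + u \<bullet> (y - x1)" for y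
  have m: "ereal (m y) \<le> f y" for y using u by (auto simp: m_def subdifferential_def)
  \<comment> \<open>large enough to lift the minorant \<open>m\<close> above \<open>r0\<close> at \<open>x0\<close>\<close>
  define k where "k = (\<bar>r0 - m x0\<bar> + 1) / (d \<bullet> x0 - c)"
  have k: "k \<ge> 0" "k * (d \<bullet> x0 - c) = \<bar>r0 - m x0\<bar> + 1"
    using horizontal(3) by (auto simp: k_def)
  show ?thesis
  proof (rule that[of "u + k *\<^sub>R d" "u \<bullet> x1 - r1 + k * c"])
    fix y
    show "ereal ((u + k *\<^sub>R d) \<bullet> y - (u \<bullet> x1 - r1 + k * c)) \<le> f y"
    proof (cases "y \<in> dom_fun f")
      case True
      then have "k * (d \<bullet> y - c) \<le> 0"
        using horizontal(2) k(1) by (simp add: mult_le_0_iff)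
      then have "(u + k *\<^sub>R d) \<bullet> y - (u \<bullet> x1 - r1 + k * c) \<le> m y"
        by (simp add: m_def inner_add_left inner_diff_right algebra_simps)
      then show ?thesis using m[of y] by (meson ereal_less_eq(3) order.trans)
    qed (simp add: dom_fun_def)
    have "(u + k *\<^sub>R d) \<bullet> x0 - (u \<bullet> x1 - r1 + k * c) = m x0 + k * (d \<bullet> x0 - c)"
      by (simp add: m_def inner_add_left inner_diff_right algebra_simps)
    then show "r0 < (u + k *\<^sub>R d) \<bullet> x0 - (u \<bullet> x1 - r1 + k * c)" using k(2) by linarith
  qed
qed

text \<open>The hypothesis says that every affine minorant of \<open>f\<close> is one of \<open>q\<close>, and \<open>f\<close> is the supremum of its
affine minorants.  This lets an upper bound on \<open>f\<close> be checked on the conjugate side.\<close>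

lemma Gamma0_le_if_conjugate_ge:
  fixes f :: "'a::euclidean_space \<Rightarrow> ereal"
  assumes f: "f \<in> Gamma0" and le: "\<And>v. conjugate q v \<le> conjugate f v"
  shows "f x \<le> q x"
proof (rule ccontr)
  assume "\<not> f x \<le> q x"
  then have "q x < f x" by simp
  then obtain r where r: "q x < ereal r" "ereal r < f x" using ereal_dense2 by blast
  obtain v c where vc: "\<And>x. ereal (v \<bullet> x - c) \<le> f x" "r < v \<bullet> x - c"
    using affine_minorant_above[OF f r(2)] by blast
  have "conjugate q v \<le> ereal c" using vc(1) le[of v] by (meson conjugate_le_iff order.trans)
  then have "ereal (v \<bullet> x - c) \<le> q x" by (simp add: conjugate_le_iff)
  also have "\<dots> < ereal r" by (rule r(1))
  finally show False using vc(2) by simp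
qed

text \<open>Convexity bounds the limit superior from above by the endpoint value, and closedness of the epigraph
bounds the limit inferior from below.\<close>

lemma closed_convex_segment_limit:
  fixes h :: "'a::euclidean_space \<Rightarrow> ereal"
  assumes lsc: "lsc_fun h" and cv: "convex_fun h"
    and H: "\<And>s. 0 \<le> s \<Longrightarrow> s \<le> 1 \<Longrightarrow> h ((1 - s) *\<^sub>R v + s *\<^sub>R w) = ereal (H s)"
  shows "(\<lambda>n. H (1 / real (Suc n))) \<longlonglongrightarrow> H 0"
proof (rule LIMSEQ_I)
  fix e :: real assume e: "e > 0"
  have hv: "h v = ereal (H 0)" and hw: "h w = ereal (H 1)" using H[of 0] H[of 1] by auto
  have s0: "(\<lambda>n. 1 / real (Suc n)) \<longlonglongrightarrow> 0"
    using LIMSEQ_inverse_real_of_nat by (simp add: inverse_eq_divide)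
  have up: "H s \<le> (1 - s) * H 0 + s * H 1" if "0 \<le> s" "s \<le> 1" for s
    using convex_funD[OF cv, of v "H 0" w "H 1" s] that hv hw H[of s] by simp
  have "(\<lambda>n. (1 - 1 / real (Suc n)) * H 0 + (1 / real (Suc n)) * H 1) \<longlonglongrightarrow> (1 - 0) * H 0 + 0 * H 1"
    by (intro tendsto_intros s0)
  then have "\<forall>\<^sub>F n in sequentially. (1 - 1 / real (Suc n)) * H 0 + (1 / real (Suc n)) * H 1 < H 0 + e"
    by (rule order_tendstoD(2)) (use e in auto)
  then have ev1: "\<forall>\<^sub>F n in sequentially. H (1 / real (Suc n)) < H 0 + e"
  proof (rule eventually_mono)
    fix n assume "(1 - 1 / real (Suc n)) * H 0 + (1 / real (Suc n)) * H 1 < H 0 + e"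
    then show "H (1 / real (Suc n)) < H 0 + e" using up[of "1 / real (Suc n)"] by fastforce
  qed
  have "open (- {(x, r::real). h x \<le> ereal r})"
    using lsc by (simp add: lsc_fun_iff_closed_epigraph closed_def)
  moreover have "(\<lambda>n. ((1 - 1 / real (Suc n)) *\<^sub>R v + (1 / real (Suc n)) *\<^sub>R w, H 0 - e))
      \<longlonglongrightarrow> ((1 - 0) *\<^sub>R v + 0 *\<^sub>R w, H 0 - e)"
    by (intro tendsto_intros s0)
  ultimately have "\<forall>\<^sub>F n in sequentially.
      ((1 - 1 / real (Suc n)) *\<^sub>R v + (1 / real (Suc n)) *\<^sub>R w, H 0 - e) \<in> - {(x, r). h x \<le> ereal r}"
    by (intro topological_tendstoD) (use hv e in auto)
  then have ev2: "\<forall>\<^sub>F n in sequentially. H 0 - e < H (1 / real (Suc n))"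
  proof (rule eventually_mono)
    fix n assume "((1 - 1 / real (Suc n)) *\<^sub>R v + (1 / real (Suc n)) *\<^sub>R w, H 0 - e) \<in> - {(x, r). h x \<le> ereal r}"
    then show "H 0 - e < H (1 / real (Suc n))" using H[of "1 / real (Suc n)"] by simp
  qed
  have "\<forall>\<^sub>F n in sequentially. norm (H (1 / real (Suc n)) - H 0) < e"
    using ev1 ev2 by eventually_elim auto
  then show "\<exists>no. \<forall>n\<ge>no. norm (H (1 / real (Suc n)) - H 0) < e"
    by (simp add: eventually_sequentially)
qed

section \<open>The conjugate of a finite Legendre function\<close>

lemma has_gradient_real_iff: "has_gradient (\<lambda>x. ereal (F x)) g x \<longleftrightarrow> GDERIV F x :> g"
  by (simp add: has_gradient_def)

lemma has_gradient_unique: "has_gradient h g x \<Longrightarrow> has_gradient h g' x \<Longrightarrow> g = g'"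
  unfolding has_gradient_def using GDERIV_unique by blast

lemma grad_eqI: "has_gradient h g x \<Longrightarrow> grad h x = g"
  unfolding grad_def using has_gradient_unique by blast

lemma norm_le_coordinates:
  fixes x :: "'a::euclidean_space"
  assumes "\<And>b. b \<in> Basis \<Longrightarrow> e * \<bar>x \<bullet> b\<bar> \<le> K" "e > 0"
  shows "norm x \<le> real DIM('a) * (K / e)"
proof -
  have "norm x \<le> (\<Sum>b\<in>Basis. \<bar>x \<bullet> b\<bar>)" by (rule norm_le_l1)
  also have "\<dots> \<le> (\<Sum>b\<in>(Basis::'a set). K / e)"
    using assms by (intro sum_mono) (simp add: field_simps)
  finally show ?thesis by simp
qed

text \<open>A Legendre function that is finite everywhere: it is differentiable, and for a differentiable convex
function strict convexity is the same as injectivity of the gradient.\<close>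

locale legendre_potential =
  fixes p :: "'a::euclidean_space \<Rightarrow> real" and G :: "'a \<Rightarrow> 'a"
  assumes convex_p: "convex_on UNIV p" and grad_p: "\<And>x. GDERIV p x :> G x" and inj_G: "inj G"
begin

abbreviation pE :: "'a \<Rightarrow> ereal" where "pE \<equiv> \<lambda>x. ereal (p x)"
abbreviation pc :: "'a \<Rightarrow> ereal" where "pc \<equiv> conjugate pE"

lemma gradient_inequality: "p x + G x \<bullet> (y - x) \<le> p y"
  by (rule convex_gradient_inequality[OF convex_p grad_p])

lemma continuous_p: "continuous_on A p"
  using GDERIV_continuous[OF grad_p] by (simp add: continuous_at_imp_continuous_on)

lemma continuous_G: "continuous_on UNIV G"
  by (rule convex_gradient_continuous[OF convex_p grad_p])

lemma open_range_G: "open (range G)"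
  by (rule invariance_of_domain[OF continuous_G open_UNIV inj_G])

lemma inv_G: "inv G (G x) = x" by (rule inv_f_f[OF inj_G])

lemma G_inv: "v \<in> range G \<Longrightarrow> G (inv G v) = v" by (rule f_inv_into_f)

lemma isCont_inv_G: assumes "v \<in> range G" shows "isCont (inv G) v"
proof -
  obtain g where g: "homeomorphism UNIV (range G) G g"
    using invariance_of_domain_homeomorphism[OF open_UNIV continuous_G _ inj_G] by auto
  have "continuous_on (range G) (inv G)"
    by (rule continuous_on_eq[OF homeomorphism_cont2[OF g]])
      (metis g homeomorphism_def inv_G UNIV_I rangeE)
  then show ?thesis using assms open_range_G continuous_on_eq_continuous_at by blast
qed

lemma G_subgradient: "G x \<in> subdifferential pE x"
  using gradient_inequality by (simp add: subdifferential_def)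

lemma pc_G: "pc (G x) = ereal (G x \<bullet> x - p x)"
  by (rule subgradient_conjugate[OF G_subgradient refl])

lemma pc_ge: "ereal (v \<bullet> x - p x) \<le> pc v" by (rule conjugate_ge) simp

lemma pc_not_MInf: "pc v \<noteq> -\<infinity>" using pc_ge[of v 0] by auto

lemma pc_above_tangent: "ereal (G x \<bullet> x - p x + (u - G x) \<bullet> x) \<le> pc u"
  by (rule subgradient_conjugate_le[OF G_subgradient refl])

text \<open>The conjugate lies above its tangent at \<open>v\<close>, whose slope is \<open>inv G v\<close>, and its increment is at most that of the
tangent at \<open>u\<close>, whose slope \<open>inv G u\<close> tends to \<open>inv G v\<close>.\<close>

lemma has_gradient_pc:
  assumes "v \<in> range G"
  shows "has_gradient pc (inv G v) v"
proof -
  have nb: "\<forall>\<^sub>F u in nhds v. u \<in> range G"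
    using open_range_G assms by (rule eventually_nhds_in_open)
  have fin: "pc u = ereal (u \<bullet> inv G u - p (inv G u))" if "u \<in> range G" for u
    using pc_G[of "inv G u"] G_inv[OF that] by simp
  let ?P = "\<lambda>u. real_of_ereal (pc u)"
  have up: "?P u - ?P v - inv G v \<bullet> (u - v) \<le> (inv G u - inv G v) \<bullet> (u - v)"
    if "u \<in> range G" for u
    using pc_above_tangent[of "inv G u" v] that assms
    by (simp add: fin G_inv inner_diff_left inner_diff_right inner_commute)
  have lo: "0 \<le> ?P u - ?P v - inv G v \<bullet> (u - v)" if "u \<in> range G" for u
    using pc_above_tangent[of "inv G v" u] that assms
    by (simp add: fin G_inv inner_diff_left inner_diff_right inner_commute)
  have "GDERIV ?P v :> inv G v"
    unfolding GDERIV_expansion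
  proof (intro allI impI)
    fix e :: real assume "e > 0"
    then obtain d where d: "d > 0" "\<And>u. dist u v < d \<Longrightarrow> dist (inv G u) (inv G v) < e"
      using isCont_inv_G[OF assms] unfolding continuous_at_eps_delta by blast
    obtain d' where d': "d' > 0" "ball v d' \<subseteq> range G"
      using open_range_G assms open_contains_ball by blast
    show "\<exists>d>0. \<forall>u. norm (u - v) < d \<longrightarrow>
        \<bar>?P u - ?P v - inv G v \<bullet> (u - v)\<bar> \<le> e * norm (u - v)"
    proof (intro exI[of _ "min d d'"] conjI allI impI)
      fix u assume u: "norm (u - v) < min d d'"
      then have ur: "u \<in> range G" using d' by (auto simp: dist_norm norm_minus_commute)
      have "norm (inv G u - inv G v) \<le> e" using d(2)[of u] u by (simp add: dist_norm)
      then have "(inv G u - inv G v) \<bullet> (u - v) \<le> e * norm (u - v)"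
        by (meson norm_cauchy_schwarz mult_right_mono norm_ge_zero order.trans)
      then show "\<bar>?P u - ?P v - inv G v \<bullet> (u - v)\<bar> \<le> e * norm (u - v)"
        using up[OF ur] lo[OF ur] by linarith
    qed (use d d' in auto)
  qed
  moreover have "\<forall>\<^sub>F u in nhds v. \<bar>pc u\<bar> \<noteq> \<infinity>"
    using nb by eventually_elim (simp add: fin)
  ultimately show ?thesis by (simp add: has_gradient_def)
qed

lemma grad_pc: "v \<in> range G \<Longrightarrow> grad pc v = inv G v"
  by (rule grad_eqI[OF has_gradient_pc])

text \<open>Around an interior point of the domain, the conjugate is bounded on the finitely many points
\<open>w \<plusminus> e b\<close>.  These already bound every coordinate in
the two compactness arguments below, so finiteness at single points suffices.\<close>

lemma interior_dom_finite_stencil: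
  assumes "w \<in> interior (dom_fun pc)"
  obtains e M where "e > 0" "\<And>b. b \<in> Basis \<Longrightarrow> pc (w + e *\<^sub>R b) \<le> ereal M"
    "\<And>b. b \<in> Basis \<Longrightarrow> pc (w - e *\<^sub>R b) \<le> ereal M"
proof -
  obtain e where e: "e > 0" "cball w e \<subseteq> dom_fun pc"
    using assms by (meson mem_interior_cball)
  let ?A = "(\<lambda>b. w + e *\<^sub>R b) ` Basis \<union> (\<lambda>b. w - e *\<^sub>R b) ` Basis"
  let ?M = "Max ((\<lambda>u. real_of_ereal (pc u)) ` ?A)"
  have le: "pc u \<le> ereal ?M" if u: "u \<in> ?A" for u
  proof -
    have "u \<in> cball w e" using u e by (auto simp: dist_norm)
    then have "pc u < \<infinity>" using e by (auto simp: dom_fun_def)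
    then have "pc u = ereal (real_of_ereal (pc u))" using pc_not_MInf[of u] by (cases "pc u") auto
    moreover have "real_of_ereal (pc u) \<le> ?M" using u by (intro Max_ge) auto
    ultimately show ?thesis by (metis ereal_less_eq(3))
  qed
  show ?thesis by (rule that[OF e(1), of ?M]) (intro le; blast)+
qed

text \<open>For an interior point \<open>v\<close> the function \<open>p - v \<bullet> \<cdot>\<close> is coercive; at its minimiser the gradient of \<open>p\<close> is
\<open>v\<close>.\<close>

lemma interior_dom_subset_range: "interior (dom_fun pc) \<subseteq> range G"
proof
  fix v assume "v \<in> interior (dom_fun pc)"
  then obtain e M where e: "e > 0" and M: "\<And>b. b \<in> Basis \<Longrightarrow> pc (v + e *\<^sub>R b) \<le> ereal M"
    "\<And>b. b \<in> Basis \<Longrightarrow> pc (v - e *\<^sub>R b) \<le> ereal M"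
    by (rule interior_dom_finite_stencil) blast
  define h where "h x = p x - v \<bullet> x" for x
  define R where "R = real DIM('a) * ((h 0 + M) / e)"
  have coercive: "norm x \<le> R" if "h x \<le> h 0" for x
    unfolding R_def
  proof (rule norm_le_coordinates[OF _ e])
    fix b :: 'a assume b: "b \<in> Basis"
    have "(v + e *\<^sub>R b) \<bullet> x - M \<le> p x" "(v - e *\<^sub>R b) \<bullet> x - M \<le> p x"
      using M[OF b] by (simp_all add: conjugate_le_iff)
    then have "e * (x \<bullet> b) \<le> h 0 + M" "- (e * (x \<bullet> b)) \<le> h 0 + M"
      using that by (simp_all add: h_def inner_add_left inner_diff_left inner_commute[of x b])
    then show "e * \<bar>x \<bullet> b\<bar> \<le> h 0 + M" by (simp add: abs_if)
  qed
  have "R \<ge> 0" using coercive[of 0] by simp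
  moreover have "continuous_on (cball 0 R) h"
    unfolding h_def by (intro continuous_intros continuous_p)
  ultimately obtain x where x: "\<forall>y\<in>cball 0 R. h x \<le> h y"
    using continuous_attains_inf[of "cball 0 R" h] by auto
  have "h x \<le> h y" for y
  proof (cases "h y \<le> h 0")
    case True
    then show ?thesis using x coercive by simp
  next
    case False
    then show ?thesis using x \<open>R \<ge> 0\<close> by (auto dest: bspec[of _ _ 0])
  qed
  moreover have "GDERIV h x :> G x - v"
    unfolding h_def by (intro GDERIV_diff grad_p GDERIV_inner)
  ultimately have "G x - v = 0" by (intro GDERIV_at_minimum[of h x _ 1]) auto
  then show "v \<in> range G" by (metis eq_iff_diff_eq_0 rangeI)
qed

lemma range_subset_dom: "range G \<subseteq> dom_fun pc"
  by (auto simp: dom_fun_def pc_G)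

lemma interior_dom_pc: "interior (dom_fun pc) = range G"
  using interior_dom_subset_range interior_maximal[OF range_subset_dom open_range_G] by blast

text \<open>At a boundary point of its domain, \<open>pc\<close> decreases with infinite slope towards the interior.  Indeed, if the
slope along a segment into the interior stays bounded, then the points \<open>inv G v\<^sub>t\<close> stay bounded as
\<open>v\<^sub>t\<close> approaches \<open>v\<close>, and by continuity \<open>G\<close> maps any of their limit points to \<open>v\<close>.\<close>

lemma bounded_slope_imp_range:
  assumes v: "pc v = ereal a" and w: "w \<in> range G"
    and slope: "\<And>t. 0 < t \<Longrightarrow> t < 1 \<Longrightarrow> ereal (a - C * t) \<le> pc ((1 - t) *\<^sub>R v + t *\<^sub>R w)"
  shows "v \<in> range G"
proof -
  obtain e M where e: "e > 0" and M: "\<And>b. b \<in> Basis \<Longrightarrow> pc (w + e *\<^sub>R b) \<le> ereal M"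
    "\<And>b. b \<in> Basis \<Longrightarrow> pc (w - e *\<^sub>R b) \<le> ereal M"
    using w unfolding interior_dom_pc[symmetric] by (rule interior_dom_finite_stencil) blast
  \<comment> \<open>the shift by two keeps \<open>t n\<close> strictly below one\<close>
  define t where "t n = 1 / (real n + 2)" for n
  define V where "V n = (1 - t n) *\<^sub>R v + t n *\<^sub>R w" for n
  define X where "X n = inv G (V n)" for n
  have t: "0 < t n" "t n < 1" for n by (auto simp: t_def)
  have "V n \<in> range G" for n
  proof (cases "v = w")
    case True
    then have "V n = w" by (simp add: V_def algebra_simps)
    then show ?thesis using w by simp
  next
    case False
    have "v \<in> dom_fun pc" by (simp add: dom_fun_def v)
    then have "v \<in> closure (dom_fun pc)" using closure_subset by blast
    then have "open_segment w v \<subseteq> interior (dom_fun pc)"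
      using w interior_dom_pc
      by (intro in_interior_closure_convex_segment convex_dom_fun convex_fun_conjugate) simp_all
    moreover have "V n \<in> open_segment v w" using t False by (auto simp: in_segment V_def)
    ultimately show ?thesis using interior_dom_pc by (auto simp: open_segment_commute)
  qed
  then have GX: "G (X n) = V n" for n by (simp add: X_def G_inv)
  define c where "c n = V n \<bullet> X n - p (X n)" for n
  have pcV: "pc (V n) = ereal (c n)" for n using pc_G[of "X n"] by (simp add: GX c_def)
  have tan: "c n + (u - V n) \<bullet> X n \<le> s" if "pc u \<le> ereal s" for n u s
    using order.trans[OF pc_above_tangent[of "X n" u] that] by (simp add: GX c_def)
  have c_ge: "a - C * t n \<le> c n" for n
    using slope[OF t(1)[of n] t(2)[of n]] pcV[of n] by (simp add: V_def)
  \<comment> \<open>the tangent at \<open>V n\<close>, evaluated at \<open>v\<close>\<close>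
  have Xwv: "- C \<le> (w - v) \<bullet> X n" for n
  proof -
    have "v - V n = - t n *\<^sub>R (w - v)" by (simp add: V_def algebra_simps)
    then have "c n - t n * ((w - v) \<bullet> X n) \<le> a" using tan[of v a n] v by simp
    then have "0 \<le> t n * ((w - v) \<bullet> X n + C)" using c_ge[of n] by (simp add: algebra_simps)
    then show ?thesis using t(1)[of n] by (simp add: zero_le_mult_iff)
  qed
  have bound: "norm (X n) \<le> real DIM('a) * ((M - a + C) / e)" for n
  proof (rule norm_le_coordinates[OF _ e])
    fix b :: 'a assume b: "b \<in> Basis"
    have "(w - V n) = (1 - t n) *\<^sub>R (w - v)" by (simp add: V_def algebra_simps)
    then have "(w - V n) \<bullet> X n = (1 - t n) * ((w - v) \<bullet> X n)" by simp
    moreover have "(1 - t n) * (- C) \<le> (1 - t n) * ((w - v) \<bullet> X n)"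
      using t[of n] Xwv[of n] by (intro mult_left_mono) auto
    ultimately have "a - C \<le> c n + (w - V n) \<bullet> X n" using c_ge[of n] by (simp add: algebra_simps)
    moreover have "c n + (w - V n) \<bullet> X n + e * (X n \<bullet> b) \<le> M"
      "c n + (w - V n) \<bullet> X n - e * (X n \<bullet> b) \<le> M"
      using tan[OF M(1)[OF b], of n] tan[OF M(2)[OF b], of n]
      by (simp_all add: inner_add_left inner_diff_left inner_commute algebra_simps)
    ultimately have "e * (X n \<bullet> b) \<le> M - a + C" "- (e * (X n \<bullet> b)) \<le> M - a + C" by linarith+
    then show "e * \<bar>X n \<bullet> b\<bar> \<le> M - a + C" by (simp add: abs_if)
  qed
  then obtain x r where r: "strict_mono r" "(X \<circ> r) \<longlonglongrightarrow> x"
    using compact_cball[of 0 "real DIM('a) * ((M - a + C) / e)", unfolded compact_def, rule_format, of X]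
    by auto
  have "isCont G x" using continuous_G by (simp add: continuous_on_eq_continuous_at)
  then have "(\<lambda>n. G ((X \<circ> r) n)) \<longlonglongrightarrow> G x" by (rule isCont_tendsto_compose[OF _ r(2)])
  moreover have "t \<longlonglongrightarrow> 0"
    using LIMSEQ_ignore_initial_segment[OF lim_1_over_n, of 2] by (simp add: t_def[abs_def] add.commute)
  then have "V \<longlonglongrightarrow> (1 - 0) *\<^sub>R v + 0 *\<^sub>R w" unfolding V_def by (intro tendsto_intros)
  then have "(\<lambda>n. G ((X \<circ> r) n)) \<longlonglongrightarrow> v"
    using LIMSEQ_subseq_LIMSEQ[OF _ r(1)] by (simp add: GX o_def)
  ultimately have "G x = v" by (rule LIMSEQ_unique)
  then show ?thesis by blast
qed

end

section \<open>Anisotropic descent\<close>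

lemma inf_conv_le: "inf_conv \<xi> h x \<le> h (x - y) + \<xi> y"
  unfolding inf_conv_def by (rule INF_lower) simp

lemma C1_funE:
  assumes "C1_fun f"
  obtains F where "f = (\<lambda>x. ereal (F x))" "\<And>x. GDERIV F x :> grad f x" "continuous_on UNIV (grad f)"
proof -
  have g: "has_gradient f (grad f x) x" for x
    using assms grad_eqI unfolding C1_fun_def by metis
  have fin: "f = (\<lambda>x. ereal (real_of_ereal (f x)))"
  proof
    fix x
    have "\<forall>\<^sub>F y in nhds x. \<bar>f y\<bar> \<noteq> \<infinity>" using g[of x] by (simp add: has_gradient_def)
    then have "\<bar>f x\<bar> \<noteq> \<infinity>" by (rule eventually_nhds_x_imp_x)
    then show "f x = ereal (real_of_ereal (f x))" by (simp add: ereal_real)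
  qed
  show ?thesis
    by (rule that[OF fin]) (use g assms in \<open>auto simp: has_gradient_def C1_fun_def\<close>)
qed

lemma C1_funI:
  assumes "\<And>x. GDERIV F x :> dF x" "continuous_on UNIV dF"
  shows "C1_fun (\<lambda>x. ereal (F x))" "grad (\<lambda>x. ereal (F x)) = dF"
proof -
  have g: "has_gradient (\<lambda>x. ereal (F x)) (dF x) x" for x using assms by (simp add: has_gradient_real_iff)
  then show "grad (\<lambda>x. ereal (F x)) = dF" by (auto intro!: ext grad_eqI)
  then show "C1_fun (\<lambda>x. ereal (F x))" using g assms(2) by (auto simp: C1_fun_def)
qed

context legendre_potential
begin

text \<open>Anisotropic descent with constant one relative to \<open>p\<close>; the inverse of \<open>G\<close> stands for the gradient of the
conjugate, with which it agrees on the range of \<open>G\<close>.\<close>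

definition descends :: "('a \<Rightarrow> ereal) \<Rightarrow> bool" where
  "descends f \<longleftrightarrow> C1_fun f \<and> range (grad f) \<subseteq> range G \<and>
    (\<forall>xb x. f x \<le> f xb + pE (x - xb + inv G (grad f xb)) - pE (inv G (grad f xb)))"

text \<open>The least \<open>\<xi>\<close> for which the infimal convolution of \<open>\<xi>\<close> with \<open>p\<close> is at least \<open>F\<close>.\<close>

definition deconv :: "('a \<Rightarrow> real) \<Rightarrow> 'a \<Rightarrow> ereal" where
  "deconv F y = (SUP x. ereal (F x - p (x - y)))"

lemma deconv_le_iff: "deconv F y \<le> ereal r \<longleftrightarrow> (\<forall>x. F x - p (x - y) \<le> r)"
  by (simp add: deconv_def SUP_le_iff)

lemma deconv_ge: "ereal (F x - p (x - y)) \<le> deconv F y"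
  unfolding deconv_def by (rule SUP_upper) simp

lemma lsc_deconv: "lsc_fun (deconv F)"
proof -
  have "{(y, r). deconv F y \<le> ereal r} = (\<Inter>x. {z. F x - p (x - fst z) \<le> snd z})"
    by (auto simp: deconv_le_iff)
  moreover have "closed {z. F x - p (x - fst z) \<le> snd z}" for x
    by (intro closed_Collect_le continuous_intros continuous_on_compose2[OF continuous_p[of UNIV]]) auto
  ultimately show ?thesis unfolding lsc_fun_iff_closed_epigraph by auto
qed

lemma convex_deconv:
  assumes "convex_on UNIV F"
  shows "convex_fun (deconv F)"
proof (rule convex_funI)
  fix x y and r s t :: real
  assume le: "deconv F x \<le> ereal r" "deconv F y \<le> ereal s" and t: "0 \<le> t" "t \<le> 1"
  let ?m = "(1 - t) *\<^sub>R x + t *\<^sub>R y"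
  have "F z - p (z - ?m) \<le> (1 - t) * r + t * s" for z
  proof -
    \<comment> \<open>for fixed \<open>u = x - y\<close> the term \<open>F x - p (x - y) = F (y + u) - p u\<close> is convex in \<open>y\<close>\<close>
    define u where "u = z - ?m"
    have z: "z = (1 - t) *\<^sub>R (x + u) + t *\<^sub>R (y + u)" by (simp add: u_def algebra_simps)
    have "F z \<le> (1 - t) * F (x + u) + t * F (y + u)"
      unfolding z using assms t by (intro convex_onD) auto
    also have "\<dots> \<le> (1 - t) * (r + p u) + t * (s + p u)"
      using le[unfolded deconv_le_iff] t
      by (intro add_mono mult_left_mono) (auto simp: add.commute diff_le_eq
          dest: spec[of _ "x + u"] spec[of _ "y + u"])
    finally show ?thesis unfolding u_def[symmetric] by (simp add: algebra_simps)
  qed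
  then show "deconv F ?m \<le> ereal ((1 - t) * r + t * s)" by (simp add: deconv_le_iff)
qed

text \<open>The hypothesis says that at every point \<open>F\<close> is touched from above by a vertically shifted translate of
\<open>p\<close>.  This is what the descent inequality provides.\<close>

lemma deconv_exact:
  assumes touch: "\<And>x. \<exists>y. \<forall>x'. F x' - p (x' - y) \<le> F x - p (x - y)"
  shows "proper_fun (deconv F)" "(\<lambda>x. ereal (F x)) = inf_conv (deconv F) pE"
    "exact_inf_conv (deconv F) pE"
proof -
  have eq: "\<exists>y. deconv F y = ereal (F x - p (x - y))" for x
  proof -
    obtain y where "\<forall>x'. F x' - p (x' - y) \<le> F x - p (x - y)" using touch by blast
    then have "deconv F y = ereal (F x - p (x - y))"
      by (intro antisym deconv_ge) (simp add: deconv_le_iff)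
    then show ?thesis ..
  qed
  have nMI: "deconv F y \<noteq> -\<infinity>" for y using deconv_ge[of F y y] by auto
  then show "proper_fun (deconv F)" 
    unfolding proper_fun_def using eq[of 0] by (metis PInfty_neq_ereal(1))
  have ge: "ereal (F x) \<le> pE (x - y) + deconv F y" for x y
    using deconv_ge[of F x y] nMI[of y] by (cases "deconv F y") auto
  have at: "\<exists>y. pE (x - y) + deconv F y = ereal (F x)" for x
  proof -
    obtain y where "deconv F y = ereal (F x - p (x - y))" using eq by blast
    then show ?thesis by (intro exI[of _ y]) simp
  qed
  have conv: "inf_conv (deconv F) pE x = ereal (F x)" for x
  proof (rule antisym)
    obtain y where "pE (x - y) + deconv F y = ereal (F x)" using at by blast
    then show "inf_conv (deconv F) pE x \<le> ereal (F x)" using inf_conv_le[of "deconv F" pE x y] by simp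
    show "ereal (F x) \<le> inf_conv (deconv F) pE x" unfolding inf_conv_def by (intro INF_greatest ge)
  qed
  then show "(\<lambda>x. ereal (F x)) = inf_conv (deconv F) pE" by auto
  show "exact_inf_conv (deconv F) pE"
    unfolding exact_inf_conv_def conv
  proof
    fix x
    obtain y where "pE (x - y) + deconv F y = ereal (F x)" using at by blast
    then show "\<exists>y. ereal (F x) = pE (x - y) + deconv F y" by (intro exI[of _ y]) (rule sym)
  qed
qed

lemma descends_touching:
  assumes "descends (\<lambda>x. ereal (F x))"
  shows "\<exists>y. \<forall>x'. F x' - p (x' - y) \<le> F x - p (x - y)"
proof (intro exI allI)
  let ?z = "inv G (grad (\<lambda>x. ereal (F x)) x)"
  fix x'
  have "F x' \<le> F x + p (x' - x + ?z) - p ?z" using assms by (simp add: descends_def)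
  then show "F x' - p (x' - (x - ?z)) \<le> F x - p (x - (x - ?z))" by (simp add: algebra_simps)
qed

text \<open>The infimum need not be attained a priori, since \<open>p\<close> need not be coercive.  For an almost optimal \<open>y\<close> at \<open>xb\<close>,
the function \<open>p (\<cdot> - y) + \<xi> y - m\<close> is nonnegative and nearly minimal at \<open>xb\<close>, hence has a nearly
vanishing gradient at some nearby \<open>x'\<close>: \<open>G (x' - y)\<close> is close to \<open>dm xb\<close>.  As \<open>dm xb\<close> lies in the range of
\<open>G\<close>, where \<open>inv G\<close> is continuous, the points \<open>y\<close> converge, and the bounds
\<open>F \<le> p (\<cdot> - y) + \<xi> y\<close> pass to the limit.  The minorant \<open>m\<close> is \<open>F\<close> itself when \<open>F\<close> is
continuously differentiable, and the affine function of a subgradient when \<open>F\<close> is convex.\<close>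

lemma model_at_differentiable_minorant:
  assumes conv: "(\<lambda>x. ereal (F x)) = inf_conv \<xi> pE"
    and m: "\<And>x. GDERIV m x :> dm x" "isCont dm xb" "\<And>x. m x \<le> F x" "m xb = F xb"
    and rng: "dm xb \<in> range G"
  shows "F x \<le> F xb + p (x - xb + inv G (dm xb)) - p (inv G (dm xb))"
proof -
  define r where "r n = inverse (real (Suc n))" for n
  have r: "r n > 0" for n by (simp add: r_def)
  have r0: "r \<longlonglongrightarrow> 0" unfolding r_def by (rule LIMSEQ_inverse_real_of_nat)
  have le: "ereal (F x) \<le> pE (x - y) + \<xi> y" for x y
    using inf_conv_le[of \<xi> pE x y] fun_cong[OF conv, of x] by simp
  have "\<exists>y s. \<xi> y = ereal s \<and> p (xb - y) + s < F xb + (r n)\<^sup>2" for n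
  proof -
    have "inf_conv \<xi> pE xb < ereal (F xb + (r n)\<^sup>2)"
      using fun_cong[OF conv, of xb, symmetric] r[of n] by simp
    then obtain y where y: "pE (xb - y) + \<xi> y < ereal (F xb + (r n)\<^sup>2)"
      unfolding inf_conv_def by (auto simp: INF_less_iff)
    then show ?thesis using le[of xb y] by (cases "\<xi> y") auto
  qed
  then obtain Y s where Y: "\<And>n. \<xi> (Y n) = ereal (s n)" "\<And>n. p (xb - Y n) + s n < F xb + (r n)\<^sup>2"
    by metis
  have above: "F x \<le> p (x - Y n) + s n" for x n using le[of x "Y n"] Y(1)[of n] by simp
  define g where "g n x = p (x - Y n) + s n - m x" for n x
  have dg: "GDERIV (g n) x :> G (x - Y n) - dm x" for n x
  proof -
    have "GDERIV (\<lambda>x. p (1 *\<^sub>R x + (- Y n))) x :> 1 *\<^sub>R G (x - Y n)"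
      by (rule GDERIV_affine) (simp add: grad_p)
    then have "GDERIV (\<lambda>x. p (x - Y n)) x :> G (x - Y n)" by simp
    then have "GDERIV (\<lambda>x. p (x - Y n) + s n - m x) x :> (G (x - Y n) + 0) - dm x"
      by (intro GDERIV_diff GDERIV_add GDERIV_const m)
    then show ?thesis by (simp add: g_def[abs_def])
  qed
  have "\<exists>y. norm (y - xb) \<le> r n \<and> norm (G (y - Y n) - dm y) \<le> 4 * r n" for n
  proof (rule almost_minimizer_near_almost_critical[OF dg _ r])
    show "0 \<le> g n y" for y using above[of y n] m(3)[of y] by (simp add: g_def)
    show "g n xb \<le> (r n)\<^sup>2" using Y(2)[of n] m(4) by (simp add: g_def)
  qed
  then obtain X where X: "\<And>n. norm (X n - xb) \<le> r n" "\<And>n. norm (G (X n - Y n) - dm (X n)) \<le> 4 * r n"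
    by metis
  have "(\<lambda>n. X n - xb) \<longlonglongrightarrow> 0" by (rule Lim_null_comparison[OF _ r0]) (use X in auto)
  then have Xlim: "X \<longlonglongrightarrow> xb" by (simp add: LIM_zero_iff)
  have "(\<lambda>n. G (X n - Y n) - dm (X n)) \<longlonglongrightarrow> 0"
    by (rule Lim_null_comparison[of _ "\<lambda>n. 4 * r n"]) (use X tendsto_mult_right_zero[OF r0] in auto)
  moreover have "(\<lambda>n. dm (X n)) \<longlonglongrightarrow> dm xb" by (rule isCont_tendsto_compose[OF m(2) Xlim])
  ultimately have "(\<lambda>n. (G (X n - Y n) - dm (X n)) + dm (X n)) \<longlonglongrightarrow> 0 + dm xb" by (rule tendsto_add)
  then have "(\<lambda>n. G (X n - Y n)) \<longlonglongrightarrow> dm xb" by simp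
  then have "(\<lambda>n. inv G (G (X n - Y n))) \<longlonglongrightarrow> inv G (dm xb)"
    by (rule isCont_tendsto_compose[OF isCont_inv_G[OF rng]])
  then have "(\<lambda>n. X n - (X n - Y n)) \<longlonglongrightarrow> xb - inv G (dm xb)"
    unfolding inv_G by (intro tendsto_diff Xlim)
  then have Ylim: "Y \<longlonglongrightarrow> xb - inv G (dm xb)" by simp
  have pcont: "isCont p y" for y by (rule GDERIV_continuous[OF grad_p])
  have "(\<lambda>n. F xb + (r n)\<^sup>2 + p (x - Y n) - p (xb - Y n)) \<longlonglongrightarrow>
      F xb + 0\<^sup>2 + p (x - (xb - inv G (dm xb))) - p (xb - (xb - inv G (dm xb)))"
    by (intro tendsto_intros r0 isCont_tendsto_compose[OF pcont] Ylim)
  moreover have "F x \<le> F xb + (r n)\<^sup>2 + p (x - Y n) - p (xb - Y n)" for n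
    using above[of x n] Y(2)[of n] by linarith
  ultimately have "F x \<le> F xb + 0\<^sup>2 + p (x - (xb - inv G (dm xb))) - p (xb - (xb - inv G (dm xb)))"
    by (intro LIMSEQ_le_const) auto
  then show ?thesis by (simp add: algebra_simps)
qed

lemma descends_iff_inf_conv:
  "descends f \<longleftrightarrow> C1_fun f \<and> range (grad f) \<subseteq> range G \<and> (\<exists>\<xi>. f = inf_conv \<xi> pE)"
proof (cases "C1_fun f")
  case True
  then obtain F where F: "f = (\<lambda>x. ereal (F x))" "\<And>x. GDERIV F x :> grad f x" "continuous_on UNIV (grad f)"
    by (rule C1_funE) blast
  show ?thesis
  proof
    assume "descends f"
    then show "C1_fun f \<and> range (grad f) \<subseteq> range G \<and> (\<exists>\<xi>. f = inf_conv \<xi> pE)"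
      using deconv_exact(2)[OF descends_touching, of F] by (auto simp: descends_def F(1))
  next
    assume *: "C1_fun f \<and> range (grad f) \<subseteq> range G \<and> (\<exists>\<xi>. f = inf_conv \<xi> pE)"
    then obtain \<xi> where \<xi>: "(\<lambda>x. ereal (F x)) = inf_conv \<xi> pE" using F(1) by auto
    have "F x \<le> F xb + p (x - xb + inv G (grad f xb)) - p (inv G (grad f xb))" for x xb
      by (rule model_at_differentiable_minorant[OF \<xi> F(2)])
        (use F(3) * in \<open>auto simp: continuous_on_eq_continuous_at\<close>)
    then show "descends f" using * F(1) unfolding descends_def by auto
  qed
qed (simp add: descends_def)

lemma descends_exact_inf_conv:
  assumes "descends f"
  obtains \<xi> where "proper_fun \<xi>" "lsc_fun \<xi>" "f = inf_conv \<xi> pE" "exact_inf_conv \<xi> pE"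
    "convex_fun f \<Longrightarrow> convex_fun \<xi>"
proof -
  from assms have "C1_fun f" by (simp add: descends_def)
  then obtain F where F: "f = (\<lambda>x. ereal (F x))" by (rule C1_funE) blast
  note d = deconv_exact[OF descends_touching[OF assms[unfolded F]]]
  show ?thesis
  proof (rule that[OF d(1) lsc_deconv _ d(3)])
    show "f = inf_conv (deconv F) pE" using d(2) F by simp
    show "convex_fun (deconv F)" if "convex_fun f"
      using that unfolding F convex_fun_real_iff by (rule convex_deconv)
  qed
qed

text \<open>The affine minorant and the model squeeze \<open>F\<close> between two functions with the same gradient at \<open>xb\<close>;
so a convex \<open>F\<close> is differentiable, and its gradient is automatically continuous.\<close>

lemma descends_if_subgradient_models:
  assumes cv: "convex_on UNIV F"
    and ex: "\<And>xb. \<exists>v\<in>range G. v \<in> subdifferential (\<lambda>x. ereal (F x)) xb \<and>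
      (\<forall>x. F x \<le> F xb + p (x - xb + inv G v) - p (inv G v))"
  shows "descends (\<lambda>x. ereal (F x))"
proof -
  obtain dF where dF: "\<And>x. dF x \<in> range G" "\<And>x y. F x + dF x \<bullet> (y - x) \<le> F y"
    "\<And>xb x. F x \<le> F xb + p (x - xb + inv G (dF xb)) - p (inv G (dF xb))"
  proof -
    have "\<forall>xb. \<exists>v. v \<in> range G \<and> (\<forall>y. F xb + v \<bullet> (y - xb) \<le> F y) \<and>
        (\<forall>x. F x \<le> F xb + p (x - xb + inv G v) - p (inv G v))"
    proof
      fix xb
      show "\<exists>v. v \<in> range G \<and> (\<forall>y. F xb + v \<bullet> (y - xb) \<le> F y) \<and>
          (\<forall>x. F x \<le> F xb + p (x - xb + inv G v) - p (inv G v))"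
        using ex[of xb] unfolding subdifferential_def by auto
    qed
    then show thesis using that by metis
  qed
  have gF: "GDERIV F xb :> dF xb" for xb
  proof (rule GDERIV_sandwich[OF _ _ dF(2)[of xb] dF(3)])
    have "GDERIV (\<lambda>x. (F xb - dF xb \<bullet> xb) + dF xb \<bullet> x) xb :> 0 + dF xb"
      by (intro GDERIV_add GDERIV_const GDERIV_inner)
    then show "GDERIV (\<lambda>x. F xb + dF xb \<bullet> (x - xb)) xb :> dF xb"
      by (simp add: inner_diff_right algebra_simps)
    let ?z = "inv G (dF xb)"
    have "GDERIV (\<lambda>x. p (1 *\<^sub>R x + (?z - xb))) xb :> 1 *\<^sub>R G (inv G (dF xb))"
      by (rule GDERIV_affine) (simp add: grad_p)
    then have "GDERIV (\<lambda>x. (F xb - p ?z) + p (x - xb + ?z)) xb :> 0 + dF xb"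
      using dF(1) by (intro GDERIV_add GDERIV_const) (simp add: G_inv algebra_simps)
    then show "GDERIV (\<lambda>x. F xb + p (x - xb + ?z) - p ?z) xb :> dF xb"
      by (simp add: algebra_simps)
  qed auto
  note C1 = C1_funI[OF gF convex_gradient_continuous[OF cv gF]]
  show ?thesis unfolding descends_def C1(2) using C1(1) dF by auto
qed

lemma inf_conv_real:
  assumes f: "proper_fun f" "f = inf_conv \<xi> pE"
  obtains F where "f = (\<lambda>x. ereal (F x))"
proof -
  obtain x0 where "f x0 \<noteq> \<infinity>" using f by (auto simp: proper_fun_def)
  then have "inf_conv \<xi> pE x0 < \<infinity>" using f(2) by simp
  then obtain y where y: "pE (x0 - y) + \<xi> y < \<infinity>" unfolding inf_conv_def INF_less_iff by blast
  have "f x \<le> pE (x - y) + \<xi> y" for x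
    using inf_conv_le[of \<xi> pE x y] fun_cong[OF f(2), of x] by simp
  moreover have "pE (x - y) + \<xi> y < \<infinity>" for x using y by (cases "\<xi> y") auto
  ultimately have "f x \<noteq> \<infinity>" for x by (metis ereal_infty_less_eq(1) less_irrefl)
  then have "f = (\<lambda>x. ereal (real_of_ereal (f x)))"
    using f(1) unfolding proper_fun_def by (intro ext) (metis abs_eq_infinity_cases ereal_real')
  then show ?thesis by (rule that)
qed

lemma convex_descends_iff_inf_conv:
  assumes f: "proper_fun f" "convex_fun f"
  shows "descends f \<longleftrightarrow> (\<Union>x. subdifferential f x) \<subseteq> range G \<and> (\<exists>\<xi>. f = inf_conv \<xi> pE)"
proof
  assume d: "descends f"
  then have "C1_fun f" by (simp add: descends_def)
  then obtain F where F: "f = (\<lambda>x. ereal (F x))" "\<And>x. GDERIV F x :> grad f x" by (rule C1_funE) blast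
  have "v \<in> range G" if "v \<in> subdifferential f x" for v x
  proof -
    have "GDERIV (\<lambda>y. (F x - v \<bullet> x) + v \<bullet> y) x :> 0 + v"
      by (intro GDERIV_add GDERIV_const GDERIV_inner)
    then have "0 + v = grad f x"
      by (rule GDERIV_touching[OF _ F(2)])
        (use that in \<open>auto simp: F(1) subdifferential_def inner_diff_right algebra_simps\<close>)
    then show ?thesis using d by (auto simp: descends_def)
  qed
  then show "(\<Union>x. subdifferential f x) \<subseteq> range G \<and> (\<exists>\<xi>. f = inf_conv \<xi> pE)"
    using d descends_iff_inf_conv by auto
next
  assume *: "(\<Union>x. subdifferential f x) \<subseteq> range G \<and> (\<exists>\<xi>. f = inf_conv \<xi> pE)"
  then obtain \<xi> where \<xi>: "f = inf_conv \<xi> pE" by blast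
  obtain F where F: "f = (\<lambda>x. ereal (F x))" using inf_conv_real[OF f(1) \<xi>] by blast
  have cv: "convex_on UNIV F" using f(2) unfolding F convex_fun_real_iff .
  show "descends f"
    unfolding F
  proof (rule descends_if_subgradient_models[OF cv])
    fix xb
    obtain v where v: "\<And>y. F xb + v \<bullet> (y - xb) \<le> F y" using convex_subgradient_exists[OF cv] by metis
    then have sub: "v \<in> subdifferential (\<lambda>x. ereal (F x)) xb" by (simp add: subdifferential_def)
    then have rng: "v \<in> range G" using * by (auto simp: F)
    have "F x \<le> F xb + p (x - xb + inv G v) - p (inv G v)" for x
    proof (rule model_at_differentiable_minorant[of F \<xi> "\<lambda>y. (F xb - v \<bullet> xb) + v \<bullet> y" "\<lambda>_. v"])
      show "GDERIV (\<lambda>y. (F xb - v \<bullet> xb) + v \<bullet> y) x :> v" for x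
      proof -
        have "GDERIV (\<lambda>y. (F xb - v \<bullet> xb) + v \<bullet> y) x :> 0 + v"
          by (intro GDERIV_add GDERIV_const GDERIV_inner)
        then show ?thesis by simp
      qed
    qed (use v \<xi> F rng in \<open>auto simp: inner_diff_right algebra_simps\<close>)
    then show "\<exists>v\<in>range G. v \<in> subdifferential (\<lambda>x. ereal (F x)) xb \<and>
        (\<forall>x. F x \<le> F xb + p (x - xb + inv G v) - p (inv G v))"
      using sub rng by blast
  qed
qed

end

section \<open>Descent of convex functions in terms of conjugates\<close>

context legendre_potential
begin

text \<open>Properness and exactness keep infinite values out of the sums.\<close>

lemma conjugate_inf_conv:
  assumes \<xi>: "proper_fun \<xi>" and ex: "exact_inf_conv \<xi> pE"
    and F: "(\<lambda>x. ereal (F x)) = inf_conv \<xi> pE"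
  shows "conjugate (\<lambda>x. ereal (F x)) v = conjugate \<xi> v + pc v"
proof (rule antisym)
  show "conjugate (\<lambda>x. ereal (F x)) v \<le> conjugate \<xi> v + pc v"
    unfolding conjugate_def[of "\<lambda>x. ereal (F x)"]
  proof (rule SUP_least)
    fix x
    obtain y where y: "ereal (F x) = pE (x - y) + \<xi> y"
      using ex fun_cong[OF F, of x] unfolding exact_inf_conv_def by metis
    then obtain s where s: "\<xi> y = ereal s" by (cases "\<xi> y") auto
    have "ereal (v \<bullet> y - s) + ereal (v \<bullet> (x - y) - p (x - y)) \<le> conjugate \<xi> v + pc v"
      using s by (intro add_mono pc_ge conjugate_ge) auto
    then show "ereal (v \<bullet> x) - ereal (F x) \<le> conjugate \<xi> v + pc v"
      using y s by (simp add: inner_diff_right algebra_simps)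
  qed
next
  have le: "ereal (F x) \<le> pE (x - y) + \<xi> y" for x y
    using inf_conv_le[of \<xi> pE x y] fun_cong[OF F, of x] by simp
  obtain y0 where y0: "\<xi> y0 \<noteq> \<infinity>" using \<xi> by (auto simp: proper_fun_def)
  show "conjugate \<xi> v + pc v \<le> conjugate (\<lambda>x. ereal (F x)) v"
  proof (cases "conjugate (\<lambda>x. ereal (F x)) v")
    case (real c)
    then have "conjugate (\<lambda>x. ereal (F x)) v \<le> ereal c" by simp
    then have c: "v \<bullet> x - c \<le> F x" for x by (simp add: conjugate_le_iff)
    have 1: "conjugate \<xi> v \<le> ereal (c - (v \<bullet> u - p u))" for u
      unfolding conjugate_le_iff
    proof
      fix y
      have "ereal (F (y + u)) \<le> pE u + \<xi> y" using le[of "y + u" y] by simp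
      then show "ereal (v \<bullet> y - (c - (v \<bullet> u - p u))) \<le> \<xi> y"
        using c[of "y + u"] by (cases "\<xi> y") (auto simp: inner_add_right)
    qed
    then obtain d where d: "conjugate \<xi> v = ereal d"
      using 1[of 0] conjugate_gt_MInf[of \<xi> y0 v] y0 by (cases "conjugate \<xi> v") auto
    have "pc v \<le> ereal (c - d)" unfolding conjugate_le_iff
      using 1 unfolding d by (auto simp: algebra_simps)
    then have "ereal d + pc v \<le> ereal d + ereal (c - d)" by (rule add_left_mono)
    then show ?thesis by (simp add: d real)
  next
    case MInf
    then show ?thesis using conjugate_gt_MInf[of "\<lambda>x. ereal (F x)" 0 v] by simp
  qed simp
qed

text \<open>Conjugation turns the convolution into a sum with \<open>\<psi>\<close> the conjugate of \<open>\<xi>\<close>.  Any gradient of \<open>f\<close>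
lies in the range of \<open>G\<close> and makes the conjugate of \<open>f\<close> finite, so it is a common point of the two
domains.\<close>

lemma descends_imp_conjugate_decomposition:
  assumes d: "descends f" and cv: "convex_fun f"
  shows "\<exists>\<psi>\<in>Gamma0. conjugate f = (\<lambda>v. \<psi> v + pc v) \<and> dom_fun \<psi> \<inter> interior (dom_fun pc) \<noteq> {}"
proof -
  obtain \<xi> where \<xi>: "proper_fun \<xi>" "f = inf_conv \<xi> pE" "exact_inf_conv \<xi> pE"
    using descends_exact_inf_conv[OF d] by metis
  have "C1_fun f" using d by (simp add: descends_def)
  then obtain F where F: "f = (\<lambda>x. ereal (F x))" "\<And>x. GDERIV F x :> grad f x" by (rule C1_funE) blast
  have eq: "conjugate f v = conjugate \<xi> v + pc v" for v
    using conjugate_inf_conv[OF \<xi>(1) \<xi>(3)] \<xi>(2) F(1) by auto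
  define v where "v = grad f 0"
  have "convex_on UNIV F" using cv unfolding F(1) convex_fun_real_iff .
  then have "v \<in> subdifferential f 0"
    using convex_gradient_inequality[OF _ F(2), of 0] by (simp add: subdifferential_def v_def F(1))
  then have "conjugate f v = ereal (v \<bullet> 0 - F 0)" by (rule subgradient_conjugate) (simp add: F(1))
  then have fin: "conjugate \<xi> v \<noteq> \<infinity>" using eq[of v] by auto
  obtain y0 where y0: "\<xi> y0 \<noteq> \<infinity>" using \<xi>(1) by (auto simp: proper_fun_def)
  have "conjugate \<xi> \<in> Gamma0"
    using fin conjugate_gt_MInf[of \<xi> y0, OF y0] lsc_fun_conjugate convex_fun_conjugate
    by (auto simp: Gamma0_def proper_fun_def)
  moreover have "v \<in> dom_fun (conjugate \<xi>) \<inter> interior (dom_fun pc)"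
    using fin d by (auto simp: dom_fun_def[of "conjugate \<xi>"] interior_dom_pc v_def descends_def)
  ultimately show ?thesis using eq by (intro bexI[of _ "conjugate \<xi>"]) auto
qed

text \<open>On the domain of the conjugate of \<open>f\<close> the difference is \<open>\<psi>\<close>.  The relative interior is dense in that domain, so
the open set \<open>interior (dom_fun pc)\<close>, which meets the domain, meets its relative interior as well.\<close>

lemma conjugate_decomposition_imp_convex_difference:
  assumes \<psi>: "\<psi> \<in> Gamma0" and eq: "conjugate f = (\<lambda>v. \<psi> v + pc v)"
    and ne: "dom_fun \<psi> \<inter> interior (dom_fun pc) \<noteq> {}"
  shows "dom_fun (conjugate f) \<subseteq> dom_fun pc"
    "rel_interior (dom_fun (conjugate f)) \<inter> interior (dom_fun pc) \<noteq> {}"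
    "convex_on (rel_interior (dom_fun (conjugate f))) (\<lambda>v. real_of_ereal (conjugate f v - pc v))"
proof -
  let ?D = "dom_fun (conjugate f)"
  have D: "v \<in> ?D \<longleftrightarrow> v \<in> dom_fun \<psi> \<and> v \<in> dom_fun pc" for v
    unfolding dom_fun_def eq by (cases "\<psi> v"; cases "pc v") auto
  then show "?D \<subseteq> dom_fun pc" by blast
  have cvD: "convex ?D" by (intro convex_dom_fun convex_fun_conjugate)
  have "interior (dom_fun pc) \<inter> closure ?D \<noteq> {}"
    using ne D interior_subset[of "dom_fun pc"] closure_subset[of ?D] by blast
  then show "rel_interior ?D \<inter> interior (dom_fun pc) \<noteq> {}"
    using open_inter_closure_rel_interior[OF cvD open_interior] by blast
  have fin: "\<exists>r. \<psi> v = ereal r \<and> real_of_ereal (conjugate f v - pc v) = r" if "v \<in> rel_interior ?D" for v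
  proof -
    have "v \<in> ?D" using that rel_interior_subset by blast
    then have "\<psi> v < \<infinity>" "pc v < \<infinity>" using D by (auto simp: dom_fun_def)
    moreover have "\<psi> v \<noteq> -\<infinity>" using \<psi> by (simp add: Gamma0_def proper_fun_def)
    ultimately show ?thesis
      using pc_not_MInf[of v] unfolding eq by (cases "\<psi> v"; cases "pc v") auto
  qed
  have cvr: "convex (rel_interior ?D)" using cvD by (rule convex_rel_interior)
  show "convex_on (rel_interior ?D) (\<lambda>v. real_of_ereal (conjugate f v - pc v))"
  proof (rule convex_onI[OF _ cvr])
    fix t :: real and x y assume t: "0 < t" "t < 1" and xy: "x \<in> rel_interior ?D" "y \<in> rel_interior ?D"
    then have m: "(1 - t) *\<^sub>R x + t *\<^sub>R y \<in> rel_interior ?D"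
      using cvr by (intro convexD_alt) auto
    show "real_of_ereal (conjugate f ((1 - t) *\<^sub>R x + t *\<^sub>R y) - pc ((1 - t) *\<^sub>R x + t *\<^sub>R y))
      \<le> (1 - t) * real_of_ereal (conjugate f x - pc x) + t * real_of_ereal (conjugate f y - pc y)"
      using fin[OF xy(1)] fin[OF xy(2)] fin[OF m] t \<psi>
        convex_funD[of \<psi> x "real_of_ereal (conjugate f x - pc x)" y "real_of_ereal (conjugate f y - pc y)" t]
      by (auto simp: Gamma0_def)
  qed
qed

text \<open>For a subgradient \<open>v\<close> at \<open>x0\<close>, the hypothesis \<open>fc\<close> puts the difference of the conjugates above its tangent
at \<open>v\<close>.  Rearranged, it says that the conjugate of \<open>f\<close> dominates the conjugate of the model.\<close>

lemma le_model_if_conjugate_above_tangent: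
  assumes f: "f \<in> Gamma0" and z: "v = G z"
    and fc: "\<And>u. u \<in> dom_fun (conjugate f) \<Longrightarrow> \<exists>a b. conjugate f u = ereal a \<and> pc u = ereal b \<and>
      (v \<bullet> x0 - r) - (v \<bullet> z - p z) + (u - v) \<bullet> (x0 - z) \<le> a - b"
  shows "f x \<le> ereal (r + p (x - x0 + z) - p z)"
proof (rule Gamma0_le_if_conjugate_ge[OF f])
  fix u
  show "conjugate (\<lambda>x. ereal (r + p (x - x0 + z) - p z)) u \<le> conjugate f u"
  proof (cases "u \<in> dom_fun (conjugate f)")
    case True
    then obtain a b where ab: "conjugate f u = ereal a" "pc u = ereal b"
      "(v \<bullet> x0 - r) - (v \<bullet> z - p z) + (u - v) \<bullet> (x0 - z) \<le> a - b" using fc by blast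
    have "pc u \<le> ereal b" using ab by simp
    then have b: "u \<bullet> y - b \<le> p y" for y by (simp add: conjugate_le_iff)
    have "u \<bullet> x - a \<le> r + p (x - x0 + z) - p z" for x
      using b[of "x - x0 + z"] ab(3)
      by (simp add: inner_add_right inner_diff_right inner_diff_left)
    then show ?thesis unfolding ab(1) conjugate_le_iff by simp
  qed (simp add: dom_fun_def)
qed

text \<open>Along the segment from \<open>v\<close> to \<open>u\<close>, \<open>A\<close> has slope at least \<open>(u - v) \<bullet> x0\<close> at \<open>v\<close>, whereas \<open>pc\<close> is differentiable there
with gradient \<open>inv G v\<close>.  The chord of the convex difference is therefore at least as steep as
\<open>(u - v) \<bullet> (x0 - inv G v)\<close>.\<close>

lemma difference_above_tangent:
  assumes v: "v \<in> range G" and u: "pc u = ereal b"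
    and x0: "\<And>t. 0 \<le> t \<Longrightarrow> t \<le> 1 \<Longrightarrow> A 0 + t * ((u - v) \<bullet> x0) \<le> A t"
    and cv: "\<And>t. 0 \<le> t \<Longrightarrow> t \<le> 1 \<Longrightarrow>
      A t - real_of_ereal (pc ((1 - t) *\<^sub>R v + t *\<^sub>R u)) \<le>
      (1 - t) * (A 0 - real_of_ereal (pc v)) + t * (A 1 - b)"
  shows "A 0 - real_of_ereal (pc v) + (u - v) \<bullet> (x0 - inv G v) \<le> A 1 - b"
proof (rule field_le_epsilon)
  fix e :: real assume e: "e > 0"
  let ?P = "\<lambda>u. real_of_ereal (pc u)"
  define e' where "e' = e / (norm (u - v) + 1)"
  have "norm (u - v) + 1 > 0" by (simp add: add_nonneg_pos)
  then have e': "e' > 0" "e' * norm (u - v) \<le> e" using e by (auto simp: e'_def field_simps)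
  have "GDERIV ?P v :> inv G v" using has_gradient_pc[OF v] by (simp add: has_gradient_def)
  then obtain d where d: "d > 0" "\<And>w. norm (w - v) < d \<Longrightarrow>
      \<bar>?P w - ?P v - inv G v \<bullet> (w - v)\<bar> \<le> e' * norm (w - v)"
    unfolding GDERIV_expansion using e'(1) by blast
  \<comment> \<open>one difference quotient, taken where the linear expansion of \<open>pc\<close> is accurate\<close>
  define t where "t = min 1 (d / (2 * (norm (u - v) + 1)))"
  have t: "0 < t" "t \<le> 1" using d(1) by (auto simp: t_def add_nonneg_pos)
  have "t * norm (u - v) \<le> (d / (2 * (norm (u - v) + 1))) * norm (u - v)"
    by (intro mult_right_mono) (auto simp: t_def)
  also have "\<dots> < d" using d(1) \<open>norm (u - v) + 1 > 0\<close> by (simp add: field_simps add_pos_nonneg)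
  finally have td: "t * norm (u - v) < d" .
  have w: "(1 - t) *\<^sub>R v + t *\<^sub>R u - v = t *\<^sub>R (u - v)" by (simp add: algebra_simps)
  have "\<bar>?P ((1 - t) *\<^sub>R v + t *\<^sub>R u) - ?P v - inv G v \<bullet> (t *\<^sub>R (u - v))\<bar> \<le> e' * norm (t *\<^sub>R (u - v))"
    using d(2)[of "(1 - t) *\<^sub>R v + t *\<^sub>R u"] td t unfolding w by simp
  moreover have "e' * norm (t *\<^sub>R (u - v)) = t * (e' * norm (u - v))" using t by simp
  ultimately have "?P ((1 - t) *\<^sub>R v + t *\<^sub>R u) - ?P v \<le> t * (inv G v \<bullet> (u - v)) + t * (e' * norm (u - v))"
    unfolding inner_scaleR_right by linarith
  also have "\<dots> \<le> t * (inv G v \<bullet> (u - v)) + t * e"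
    using t e' by (intro add_left_mono mult_left_mono) auto
  finally have "t * (A 0 - ?P v + (u - v) \<bullet> (x0 - inv G v)) \<le> t * (A 1 - b + e)"
    using x0[of t] cv[of t] t by (simp add: inner_diff_right inner_commute[of "inv G v"] algebra_simps)
  then show "A 0 - ?P v + (u - v) \<bullet> (x0 - inv G v) \<le> A 1 - b + e" using t by simp
qed

lemma finite_on_conjugate_dom:
  assumes f: "f \<in> Gamma0" and sub: "dom_fun (conjugate f) \<subseteq> dom_fun pc"
    and v: "v \<in> dom_fun (conjugate f)"
  shows "conjugate f v = ereal (real_of_ereal (conjugate f v))" "pc v = ereal (real_of_ereal (pc v))"
proof -
  obtain x0 where "f x0 \<noteq> \<infinity>" using f by (auto simp: Gamma0_def proper_fun_def)
  then show "conjugate f v = ereal (real_of_ereal (conjugate f v))"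
    using v conjugate_gt_MInf[of f x0 v] by (cases "conjugate f v") (auto simp: dom_fun_def)
  show "pc v = ereal (real_of_ereal (pc v))"
    using v sub pc_not_MInf[of v] by (cases "pc v") (auto simp: dom_fun_def)
qed

text \<open>Shrinking towards \<open>w\<close> moves any point of the domain into the relative interior, and both conjugates
converge along the shrunken points because they are closed and convex.\<close>

lemma convex_difference_extends:
  assumes f: "f \<in> Gamma0" and sub: "dom_fun (conjugate f) \<subseteq> dom_fun pc"
    and w: "w \<in> rel_interior (dom_fun (conjugate f))"
    and cv: "convex_on (rel_interior (dom_fun (conjugate f))) (\<lambda>v. real_of_ereal (conjugate f v - pc v))"
  shows "convex_on (dom_fun (conjugate f)) (\<lambda>v. real_of_ereal (conjugate f v) - real_of_ereal (pc v))"
proof -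
  let ?D = "dom_fun (conjugate f)"
  let ?A = "\<lambda>v. real_of_ereal (conjugate f v)" and ?P = "\<lambda>v. real_of_ereal (pc v)"
  have cvD: "convex ?D" by (intro convex_dom_fun convex_fun_conjugate)
  note fin = finite_on_conjugate_dom[OF f sub]
  have wD: "w \<in> ?D" using w rel_interior_subset by blast
  define T where "T v n = (1 - 1 / real (Suc n)) *\<^sub>R v + (1 / real (Suc n)) *\<^sub>R w" for v n
  have seg: "(1 - s) *\<^sub>R v + s *\<^sub>R w \<in> ?D" if "v \<in> ?D" "0 \<le> s" "s \<le> 1" for v s
    using cvD that wD by (intro convexD_alt) auto
  have Tri: "T v n \<in> rel_interior ?D" if "v \<in> ?D" for v n
  proof -
    let ?s = "1 / real (Suc n)"
    have s: "0 < ?s" "?s \<le> 1" by auto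
    have "v - ?s *\<^sub>R (v - w) \<in> rel_interior ?D"
      by (rule rel_interior_convex_shrink[OF cvD w that s])
    then show ?thesis by (simp add: T_def algebra_simps)
  qed
  have lim: "(\<lambda>n. ?A (T v n) - ?P (T v n)) \<longlonglongrightarrow> ?A v - ?P v" if "v \<in> ?D" for v
  proof -
    have "(\<lambda>n. ?A (T v n)) \<longlonglongrightarrow> ?A ((1 - 0) *\<^sub>R v + 0 *\<^sub>R w)"
      unfolding T_def
      by (rule closed_convex_segment_limit[OF lsc_fun_conjugate convex_fun_conjugate])
        (use seg[OF that] fin in auto)
    moreover have "(\<lambda>n. ?P (T v n)) \<longlonglongrightarrow> ?P ((1 - 0) *\<^sub>R v + 0 *\<^sub>R w)"
      unfolding T_def
      by (rule closed_convex_segment_limit[OF lsc_fun_conjugate convex_fun_conjugate])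
        (use seg[OF that] fin in auto)
    ultimately show ?thesis using tendsto_diff by fastforce
  qed
  show ?thesis
  proof (rule convex_onI[OF _ cvD])
    fix t :: real and x y assume t: "0 < t" "t < 1" and xy: "x \<in> ?D" "y \<in> ?D"
    let ?m = "(1 - t) *\<^sub>R x + t *\<^sub>R y"
    have m: "?m \<in> ?D" using cvD t xy by (intro convexD_alt) auto
    have "(1 - s) *\<^sub>R ?m + s *\<^sub>R w =
        (1 - t) *\<^sub>R ((1 - s) *\<^sub>R x + s *\<^sub>R w) + t *\<^sub>R ((1 - s) *\<^sub>R y + s *\<^sub>R w)" for s
      by (simp add: algebra_simps)
    then have Tm: "T ?m n = (1 - t) *\<^sub>R T x n + t *\<^sub>R T y n" for n
      unfolding T_def .
    have \<theta>: "real_of_ereal (conjugate f (T v n) - pc (T v n)) = ?A (T v n) - ?P (T v n)"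
      if "v \<in> ?D" for v n
    proof -
      have "T v n \<in> ?D" using Tri[OF that] rel_interior_subset by blast
      then show ?thesis using fin[of "T v n"] by (metis ereal_minus(1) real_of_ereal.simps(1))
    qed
    have "?A (T ?m n) - ?P (T ?m n) \<le>
        (1 - t) * (?A (T x n) - ?P (T x n)) + t * (?A (T y n) - ?P (T y n))" for n
      using convex_onD[OF cv, of t "T x n" "T y n"] t Tri xy
      unfolding \<theta>[OF xy(1)] \<theta>[OF xy(2)] Tm[symmetric] \<theta>[OF m] by simp
    moreover have "(\<lambda>n. (1 - t) * (?A (T x n) - ?P (T x n)) + t * (?A (T y n) - ?P (T y n)))
        \<longlonglongrightarrow> (1 - t) * (?A x - ?P x) + t * (?A y - ?P y)"
      by (intro tendsto_intros lim xy)
    ultimately show "?A ?m - ?P ?m \<le> (1 - t) * (?A x - ?P x) + t * (?A y - ?P y)"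
      using LIMSEQ_le[OF lim[OF m]] by blast
  qed
qed

text \<open>For \<open>v \<in> subdifferential f x0\<close> the conjugate of \<open>f\<close> has bounded-below slope along segments
starting at \<open>v\<close>, while the convex difference stays below its chords.  So the slope of \<open>pc\<close> is bounded below as well,
which places \<open>v\<close> in the range of \<open>G\<close>.  The difference then lies
above its tangent at \<open>v\<close>, which is the model inequality at \<open>x0\<close>.  One such \<open>x0\<close> exists, and the model there
shows that \<open>f\<close> is finite; hence there are subgradients, and models, everywhere.\<close>

lemma convex_difference_imp_descends:
  assumes f: "f \<in> Gamma0" and sub: "dom_fun (conjugate f) \<subseteq> dom_fun pc"
    and ne: "rel_interior (dom_fun (conjugate f)) \<inter> interior (dom_fun pc) \<noteq> {}"
    and cv: "convex_on (rel_interior (dom_fun (conjugate f))) (\<lambda>v. real_of_ereal (conjugate f v - pc v))"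
  shows "descends f"
proof -
  let ?D = "dom_fun (conjugate f)"
  let ?A = "\<lambda>v. real_of_ereal (conjugate f v)" and ?P = "\<lambda>v. real_of_ereal (pc v)"
  obtain w where w: "w \<in> rel_interior ?D" "w \<in> range G" using ne interior_dom_pc by auto
  have wD: "w \<in> ?D" using w rel_interior_subset by blast
  have cvD: "convex ?D" by (intro convex_dom_fun convex_fun_conjugate)
  note fin = finite_on_conjugate_dom[OF f sub]
  note \<theta> = convex_onD[OF convex_difference_extends[OF f sub w(1) cv]]
  have seg: "(1 - t) *\<^sub>R v + t *\<^sub>R u \<in> ?D" if "v \<in> ?D" "u \<in> ?D" "0 \<le> t" "t \<le> 1" for v u t
    using cvD that by (intro convexD_alt) auto
  have key: "v \<in> range G \<and> (\<forall>x. f x \<le> ereal (r + p (x - x0 + inv G v) - p (inv G v)))"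
    if x0: "v \<in> subdifferential f x0" "f x0 = ereal r" for v x0 r
  proof -
    have fv: "conjugate f v = ereal (v \<bullet> x0 - r)" by (rule subgradient_conjugate[OF x0])
    then have vD: "v \<in> ?D" by (simp add: dom_fun_def)
    have Av: "?A v = v \<bullet> x0 - r" by (simp add: fv)
    have tan: "?A v + t * ((u - v) \<bullet> x0) \<le> ?A ((1 - t) *\<^sub>R v + t *\<^sub>R u)"
      if "u \<in> ?D" "0 \<le> t" "t \<le> 1" for u t
    proof -
      have "(1 - t) *\<^sub>R v + t *\<^sub>R u - v = t *\<^sub>R (u - v)" by (simp add: algebra_simps)
      then show ?thesis
        using subgradient_conjugate_le[OF x0, of "(1 - t) *\<^sub>R v + t *\<^sub>R u"] fin(1)[OF seg[OF vD that]] Av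
        by (metis ereal_less_eq(3) inner_scaleR_left)
    qed
    have rng: "v \<in> range G"
    proof (rule bounded_slope_imp_range[OF fin(2)[OF vD] w(2)])
      fix t :: real assume t: "0 < t" "t < 1"
      have "?P v - (- ((w - v) \<bullet> x0) - (?A v - ?P v) + (?A w - ?P w)) * t
          \<le> ?P ((1 - t) *\<^sub>R v + t *\<^sub>R w)"
        using tan[OF wD, of t] \<theta>[of t v w] t vD wD by (simp add: algebra_simps)
      then have "ereal (?P v - (- ((w - v) \<bullet> x0) - (?A v - ?P v) + (?A w - ?P w)) * t)
          \<le> ereal (?P ((1 - t) *\<^sub>R v + t *\<^sub>R w))" by simp
      also have "\<dots> = pc ((1 - t) *\<^sub>R v + t *\<^sub>R w)"
        using t by (intro fin(2)[symmetric] seg vD wD) auto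
      finally show "ereal (?P v - (- ((w - v) \<bullet> x0) - (?A v - ?P v) + (?A w - ?P w)) * t)
          \<le> pc ((1 - t) *\<^sub>R v + t *\<^sub>R w)" .
    qed
    then obtain z where z: "v = G z" by blast
    then have invz: "inv G v = z" by (simp add: inv_G)
    have Pv: "?P v = v \<bullet> z - p z" by (simp add: z pc_G)
    have "f x \<le> ereal (r + p (x - x0 + z) - p z)" for x
    proof (rule le_model_if_conjugate_above_tangent[OF f z])
      fix u assume u: "u \<in> ?D"
      have "?A ((1 - 0) *\<^sub>R v + 0 *\<^sub>R u) - ?P v + (u - v) \<bullet> (x0 - inv G v)
          \<le> ?A ((1 - 1) *\<^sub>R v + 1 *\<^sub>R u) - ?P u"
        by (rule difference_above_tangent[OF rng fin(2)[OF u],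
              where A="\<lambda>t. ?A ((1 - t) *\<^sub>R v + t *\<^sub>R u)"])
          (use tan[OF u] \<theta>[of _ v u] vD u in auto)
      then show "\<exists>a b. conjugate f u = ereal a \<and> pc u = ereal b \<and>
          (v \<bullet> x0 - r) - (v \<bullet> z - p z) + (u - v) \<bullet> (x0 - z) \<le> a - b"
        using fin[OF u] Av Pv invz by auto
    qed
    then show ?thesis using rng invz by simp
  qed
  obtain x0 v r where "f x0 = ereal r" "v \<in> subdifferential f x0"
    using Gamma0_subgradient_exists[OF f] by metis
  then have bd: "f x \<le> ereal (r + p (x - x0 + inv G v) - p (inv G v))" for x
    using key by blast
  have "f x \<noteq> \<infinity>" for x using bd[of x] by auto
  then have fr: "f x = ereal (real_of_ereal (f x))" for x
    using f by (cases "f x") (auto simp: Gamma0_def proper_fun_def)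
  define F where "F x = real_of_ereal (f x)" for x
  have fF: "f = (\<lambda>x. ereal (F x))" using fr by (simp add: F_def fun_eq_iff)
  have cvF: "convex_on UNIV F"
    using f unfolding Gamma0_def fF by (simp add: convex_fun_real_iff)
  show ?thesis
    unfolding fF
  proof (rule descends_if_subgradient_models[OF cvF])
    fix xb
    obtain v where v: "\<And>y. F xb + v \<bullet> (y - xb) \<le> F y" using convex_subgradient_exists[OF cvF] by metis
    then have "v \<in> subdifferential (\<lambda>x. ereal (F x)) xb" by (simp add: subdifferential_def)
    then show "\<exists>v\<in>range G. v \<in> subdifferential (\<lambda>x. ereal (F x)) xb \<and>
        (\<forall>x. F x \<le> F xb + p (x - xb + inv G v) - p (inv G v))"
      using key[of v xb "F xb"] unfolding fF by (intro bexI[of _ v]) auto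
  qed
qed

end

section \<open>Second-order conditions\<close>

text \<open>If the quadratic form were negative at \<open>v\<close>, the derivative of \<open>h\<close> along \<open>v\<close> would be negative just after \<open>x0\<close>.\<close>

lemma second_order_necessary:
  fixes h :: "'a::euclidean_space \<Rightarrow> real"
  assumes dh: "\<And>x. GDERIV h x :> dh x" and mn: "\<And>x. h x0 \<le> h x"
    and D: "(dh has_derivative D) (at x0)"
  shows "0 \<le> v \<bullet> D v"
proof (rule ccontr)
  assume "\<not> 0 \<le> v \<bullet> D v"
  then have neg: "v \<bullet> D v < 0" by simp
  define k where "k t = v \<bullet> dh (x0 + t *\<^sub>R v)" for t
  have dk: "((\<lambda>t. h (x0 + t *\<^sub>R v)) has_real_derivative k t) (at t)" for t
    unfolding k_def by (rule GDERIV_line_derivative[OF dh])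
  have "dh x0 = 0" by (rule GDERIV_at_minimum[OF dh, of 1]) (use mn in auto)
  then have k0: "k 0 = 0" by (simp add: k_def)
  have "((\<lambda>t. x0 + t *\<^sub>R v) has_derivative (\<lambda>s. s *\<^sub>R v)) (at 0)"
    by (auto intro!: derivative_eq_intros)
  moreover have "(dh has_derivative D) (at (x0 + 0 *\<^sub>R v))" using D by simp
  ultimately have "((\<lambda>t. dh (x0 + t *\<^sub>R v)) has_derivative (\<lambda>s. D (s *\<^sub>R v))) (at 0)"
    by (rule has_derivative_compose)
  then have "(k has_derivative (\<lambda>s. v \<bullet> D (s *\<^sub>R v))) (at 0)"
    unfolding k_def[abs_def] by (rule has_derivative_inner_right)
  moreover have "v \<bullet> D (s *\<^sub>R v) = (v \<bullet> D v) * s" for s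
    using linear_cmul[OF has_derivative_linear[OF D]] by simp
  ultimately have "(k has_real_derivative (v \<bullet> D v)) (at 0)"
    unfolding has_field_derivative_def by simp
  then obtain d where d: "d > 0" "\<And>s. 0 < s \<Longrightarrow> s < d \<Longrightarrow> k s < 0"
    using DERIV_neg_dec_right[of k _ 0, OF _ neg] k0 by auto
  obtain s where s: "0 < s" "s < d / 2"
    "h (x0 + (d / 2) *\<^sub>R v) - h (x0 + 0 *\<^sub>R v) = (d / 2 - 0) * k s"
    using MVT2[of 0 "d / 2" "\<lambda>t. h (x0 + t *\<^sub>R v)" k] dk d(1) by auto
  have "k s < 0" using d s by simp
  then have "(d / 2 - 0) * k s < 0" using d(1) by (simp add: mult_pos_neg)
  then show False using s(3) mn[of "x0 + (d / 2) *\<^sub>R v"] by simp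
qed

text \<open>The second difference is the increment over \<open>[0, s]\<close> of \<open>t \<mapsto> F (x + s u + t v) - F (x + t v)\<close>; the mean
value theorem reduces it to a difference of two gradients, which \<open>A\<close> approximates.\<close>

lemma second_difference_estimate:
  fixes F :: "'a::euclidean_space \<Rightarrow> real"
  assumes dF: "\<And>x. GDERIV F x :> dF x" and A: "(dF has_derivative A) (at x)" and e: "e > 0"
  shows "\<exists>d>0. \<forall>s. 0 < s \<and> s < d \<longrightarrow>
    \<bar>F (x + s *\<^sub>R u + s *\<^sub>R v) - F (x + s *\<^sub>R u) - F (x + s *\<^sub>R v) + F x - s\<^sup>2 * (v \<bullet> A u)\<bar>
    \<le> e * s\<^sup>2 * (norm v * (norm u + 2 * norm v))"
proof -
  obtain d where d: "d > 0" "\<And>y. norm (y - x) < d \<Longrightarrow> norm (dF y - dF x - A (y - x)) \<le> e * norm (y - x)"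
    using A e unfolding has_derivative_at_alt by blast
  have lin: "linear A" by (rule has_derivative_linear[OF A])
  have N: "norm u + norm v + 1 > 0" by (simp add: add_nonneg_pos)
  show ?thesis
  proof (intro exI[of _ "d / (norm u + norm v + 1)"] conjI allI impI)
    show "0 < d / (norm u + norm v + 1)" using d N by simp
    fix s assume s: "0 < s \<and> s < d / (norm u + norm v + 1)"
    then have sd: "s * norm u + s * norm v < d"
      using N d(1) by (simp add: field_simps)
    define g where "g t = F ((x + s *\<^sub>R u) + t *\<^sub>R v) - F (x + t *\<^sub>R v)" for t
    define g' where "g' t = v \<bullet> dF ((x + s *\<^sub>R u) + t *\<^sub>R v) - v \<bullet> dF (x + t *\<^sub>R v)" for t
    have "(g has_real_derivative g' t) (at t)" for t
      unfolding g_def g'_def by (intro DERIV_diff GDERIV_line_derivative[OF dF])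
    then obtain t where t: "0 < t" "t < s" "g s - g 0 = (s - 0) * g' t"
      using MVT2[of 0 s g g'] s by auto
    define r where "r y = dF y - dF x - A (y - x)" for y
    have tv: "t * norm v \<le> s * norm v" using t by (intro mult_right_mono) auto
    have n1: "norm (s *\<^sub>R u + t *\<^sub>R v) \<le> s * norm u + s * norm v"
      using norm_triangle_ineq[of "s *\<^sub>R u" "t *\<^sub>R v"] s t tv by simp
    have n2: "norm (t *\<^sub>R v) \<le> s * norm v" using t tv by simp
    have snn: "0 \<le> s * norm u" using s by simp
    have "norm (r ((x + s *\<^sub>R u) + t *\<^sub>R v)) \<le> e * norm (s *\<^sub>R u + t *\<^sub>R v)"
      using d(2)[of "(x + s *\<^sub>R u) + t *\<^sub>R v"] n1 sd unfolding r_def by (simp add: add.assoc)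
    also have "\<dots> \<le> e * (s * norm u + s * norm v)" using e n1 by (intro mult_left_mono) auto
    finally have r1: "norm (r ((x + s *\<^sub>R u) + t *\<^sub>R v)) \<le> e * (s * norm u + s * norm v)" .
    have "norm (r (x + t *\<^sub>R v)) \<le> e * norm (t *\<^sub>R v)"
      using d(2)[of "x + t *\<^sub>R v"] n2 sd snn unfolding r_def by simp
    also have "\<dots> \<le> e * (s * norm v)" using e n2 by (intro mult_left_mono) auto
    finally have r2: "norm (r (x + t *\<^sub>R v)) \<le> e * (s * norm v)" .
    have "A (s *\<^sub>R u + t *\<^sub>R v) - A (t *\<^sub>R v) = s *\<^sub>R A u"
      by (simp add: linear_add[OF lin] linear_cmul[OF lin])
    then have "dF ((x + s *\<^sub>R u) + t *\<^sub>R v) - dF (x + t *\<^sub>R v) =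
        s *\<^sub>R A u + (r ((x + s *\<^sub>R u) + t *\<^sub>R v) - r (x + t *\<^sub>R v))"
      by (simp add: r_def algebra_simps)
    then have "g' t = v \<bullet> (s *\<^sub>R A u + (r ((x + s *\<^sub>R u) + t *\<^sub>R v) - r (x + t *\<^sub>R v)))"
      unfolding g'_def by (simp flip: inner_diff_right)
    then have "g' t - s * (v \<bullet> A u) = v \<bullet> (r ((x + s *\<^sub>R u) + t *\<^sub>R v) - r (x + t *\<^sub>R v))"
      by (simp add: inner_add_right)
    also have "\<bar>\<dots>\<bar> \<le> norm v * norm (r ((x + s *\<^sub>R u) + t *\<^sub>R v) - r (x + t *\<^sub>R v))"
      by (rule Cauchy_Schwarz_ineq2)
    also have "\<dots> \<le> norm v * (e * (s * norm u + s * norm v) + e * (s * norm v))"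
      using r1 r2 norm_triangle_ineq4[of "r ((x + s *\<^sub>R u) + t *\<^sub>R v)" "r (x + t *\<^sub>R v)"]
      by (intro mult_left_mono) auto
    finally have "s * \<bar>g' t - s * (v \<bullet> A u)\<bar> \<le> s * (norm v * (e * (s * norm u + s * norm v) + e * (s * norm v)))"
      using s by (intro mult_left_mono) auto
    moreover have "g s - g 0 - s\<^sup>2 * (v \<bullet> A u) = s * (g' t - s * (v \<bullet> A u))"
      using t(3) by (simp add: power2_eq_square algebra_simps)
    then have "s * \<bar>g' t - s * (v \<bullet> A u)\<bar> = \<bar>g s - g 0 - s\<^sup>2 * (v \<bullet> A u)\<bar>"
      using s by (simp add: abs_mult)
    ultimately show "\<bar>F (x + s *\<^sub>R u + s *\<^sub>R v) - F (x + s *\<^sub>R u) - F (x + s *\<^sub>R v) + F x - s\<^sup>2 * (v \<bullet> A u)\<bar>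
      \<le> e * s\<^sup>2 * (norm v * (norm u + 2 * norm v))"
      by (simp add: g_def power2_eq_square algebra_simps)
  qed
qed

text \<open>The second difference is symmetric in its two directions, so the limits of its two
estimates coincide.\<close>

lemma gradient_derivative_symmetric:
  fixes F :: "'a::euclidean_space \<Rightarrow> real"
  assumes dF: "\<And>x. GDERIV F x :> dF x" and A: "(dF has_derivative A) (at x)"
  shows "v \<bullet> A u = u \<bullet> A v"
proof -
  define C where "C = norm v * (norm u + 2 * norm v) + norm u * (norm v + 2 * norm u) + 1"
  have C: "C > 0" by (simp add: C_def add_nonneg_pos)
  have "\<bar>v \<bullet> A u - u \<bullet> A v\<bar> \<le> 0 + e" if e: "e > 0" for e
  proof -
    have e': "e / C > 0" using e C by simp
    obtain d1 d2 where d: "d1 > 0" "d2 > 0"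
      "\<And>s. 0 < s \<Longrightarrow> s < d1 \<Longrightarrow>
        \<bar>F (x + s *\<^sub>R u + s *\<^sub>R v) - F (x + s *\<^sub>R u) - F (x + s *\<^sub>R v) + F x - s\<^sup>2 * (v \<bullet> A u)\<bar>
        \<le> e / C * s\<^sup>2 * (norm v * (norm u + 2 * norm v))"
      "\<And>s. 0 < s \<Longrightarrow> s < d2 \<Longrightarrow>
        \<bar>F (x + s *\<^sub>R v + s *\<^sub>R u) - F (x + s *\<^sub>R v) - F (x + s *\<^sub>R u) + F x - s\<^sup>2 * (u \<bullet> A v)\<bar>
        \<le> e / C * s\<^sup>2 * (norm u * (norm v + 2 * norm u))"
      using second_difference_estimate[OF dF A e', of u v] second_difference_estimate[OF dF A e', of v u]
      by blast
    define s where "s = min d1 d2 / 2"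
    have s: "0 < s" "s < d1" "s < d2" using d(1,2) by (auto simp: s_def min_def)
    have comm: "x + s *\<^sub>R v + s *\<^sub>R u = x + s *\<^sub>R u + s *\<^sub>R v" by simp
    have "\<bar>s\<^sup>2 * (v \<bullet> A u) - s\<^sup>2 * (u \<bullet> A v)\<bar> \<le>
        e / C * s\<^sup>2 * (norm v * (norm u + 2 * norm v)) + e / C * s\<^sup>2 * (norm u * (norm v + 2 * norm u))"
      using d(3)[OF s(1,2)] d(4)[OF s(1,3)] unfolding comm by linarith
    also have "\<dots> \<le> e / C * s\<^sup>2 * C"
      unfolding distrib_left[symmetric]
      by (intro mult_left_mono mult_nonneg_nonneg less_imp_le[OF e']) (auto simp: C_def)
    also have "\<dots> = s\<^sup>2 * e" using C by simp
    finally have "s\<^sup>2 * \<bar>v \<bullet> A u - u \<bullet> A v\<bar> \<le> s\<^sup>2 * e"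
      by (simp flip: right_diff_distrib add: abs_mult)
    then show ?thesis using s(1) by simp
  qed
  then have "\<bar>v \<bullet> A u - u \<bullet> A v\<bar> \<le> 0" by (rule field_le_epsilon)
  then show ?thesis by simp
qed

lemma convex_gradient_derivative_nonneg:
  fixes F :: "'a::euclidean_space \<Rightarrow> real"
  assumes cv: "convex_on UNIV F" and dF: "\<And>x. GDERIV F x :> dF x" and A: "(dF has_derivative A) (at x)"
  shows "0 \<le> v \<bullet> A v"
proof (rule second_order_necessary[where h="\<lambda>y. F y - dF x \<bullet> y" and dh="\<lambda>y. dF y - dF x" and ?x0.0=x])
  show "GDERIV (\<lambda>y. F y - dF x \<bullet> y) y :> dF y - dF x" for y
    by (intro GDERIV_diff dF GDERIV_inner)
  show "F x - dF x \<bullet> x \<le> F y - dF x \<bullet> y" for y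
    using convex_gradient_inequality[OF cv dF, of x y] by (simp add: inner_diff_right)
  show "((\<lambda>y. dF y - dF x) has_derivative A) (at x)"
    using has_derivative_diff[OF A has_derivative_const] by simp
qed

text \<open>With \<open>a = A\<inverse> d\<close> and \<open>b = B\<inverse> d\<close>, expanding \<open>0 \<le> (a - b) \<bullet> A (a - b)\<close> and bounding \<open>b \<bullet> A b\<close> by \<open>b \<bullet> B b\<close>
shows that inversion reverses the order.\<close>

lemma inverse_antimono_quadratic_form:
  fixes A B :: "'a::real_inner \<Rightarrow> 'a"
  assumes "linear A" and sym: "\<And>u v. v \<bullet> A u = u \<bullet> A v" and psd: "\<And>v. 0 \<le> v \<bullet> A v"
    and le: "\<And>v. v \<bullet> A v \<le> v \<bullet> B v" and a: "A a = d" and b: "B b = d"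
  shows "d \<bullet> b \<le> d \<bullet> a"
proof -
  have "0 \<le> (a - b) \<bullet> A (a - b)" by (rule psd)
  also have "\<dots> = a \<bullet> d - 2 * (b \<bullet> d) + b \<bullet> A b"
    using sym[of a b] a by (simp add: linear_diff[OF assms(1)] inner_diff_left inner_diff_right)
  also have "\<dots> \<le> a \<bullet> d - 2 * (b \<bullet> d) + b \<bullet> d" using le[of b] b by simp
  finally show ?thesis by (simp add: inner_commute)
qed

context legendre_potential
begin

text \<open>The model minus \<open>F\<close> is minimal at \<open>x\<close>, so its second derivative there is positive semidefinite.\<close>

lemma descends_hessian_le:
  assumes d: "descends (\<lambda>x. ereal (F x))" and dF: "\<And>x. GDERIV F x :> dF x"
    and A: "(dF has_derivative A) (at x)" and B: "(G has_derivative B) (at (inv G (dF x)))"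
  shows "v \<bullet> A v \<le> v \<bullet> B v"
proof -
  let ?z = "inv G (dF x)"
  have gr: "grad (\<lambda>x. ereal (F x)) x = dF x" for x
    using dF by (intro grad_eqI) (simp add: has_gradient_real_iff)
  have rng: "dF x \<in> range G" using d gr by (metis descends_def rangeI subsetD)
  have "0 \<le> v \<bullet> (\<lambda>h. B h - A h) v"
  proof (rule second_order_necessary[where h="\<lambda>y. (F x - p ?z) + p (1 *\<^sub>R y + (?z - x)) - F y"
        and dh="\<lambda>y. 0 + 1 *\<^sub>R G (1 *\<^sub>R y + (?z - x)) - dF y" and ?x0.0=x])
    show "GDERIV (\<lambda>y. (F x - p ?z) + p (1 *\<^sub>R y + (?z - x)) - F y) y :> 0 + 1 *\<^sub>R G (1 *\<^sub>R y + (?z - x)) - dF y" for y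
      by (intro GDERIV_diff GDERIV_add GDERIV_const GDERIV_affine grad_p dF)
    show "F x - p ?z + p (1 *\<^sub>R x + (?z - x)) - F x \<le> F x - p ?z + p (1 *\<^sub>R y + (?z - x)) - F y" for y
      using d unfolding descends_def gr by (simp add: algebra_simps)
    have "((\<lambda>y. y + (?z - x)) has_derivative (\<lambda>h. h)) (at x)"
      by (auto intro!: derivative_eq_intros)
    then have "((\<lambda>y. G (y + (?z - x))) has_derivative (\<lambda>h. B h)) (at x)"
      by (rule has_derivative_compose) (use B in simp)
    then have "((\<lambda>y. G (y + (?z - x)) - dF y) has_derivative (\<lambda>h. B h - A h)) (at x)"
      by (rule has_derivative_diff[OF _ A])
    then show "((\<lambda>y. 0 + 1 *\<^sub>R G (1 *\<^sub>R y + (?z - x)) - dF y) has_derivative (\<lambda>h. B h - A h)) (at x)"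
      by simp
  qed
  then show ?thesis by (simp add: inner_diff_right)
qed

lemma has_derivative_inv_G:
  assumes v: "v \<in> range G" and B: "(G has_derivative B) (at (inv G v))"
    and B': "bounded_linear B'" "B' \<circ> B = id"
  shows "(inv G has_derivative B') (at v)"
  by (rule has_derivative_inverse_basic[OF B B' isCont_inv_G[OF v] open_range_G v G_inv])

lemma pc_line_derivative:
  assumes "v + t *\<^sub>R d \<in> range G"
  shows "((\<lambda>t. real_of_ereal (pc (v + t *\<^sub>R d))) has_real_derivative d \<bullet> inv G (v + t *\<^sub>R d)) (at t)"
  using has_gradient_pc[OF assms] by (intro GDERIV_line_derivative) (simp add: has_gradient_def)

lemma inv_G_line_derivative:
  assumes "v + t *\<^sub>R d \<in> range G" and B: "(G has_derivative B) (at (inv G (v + t *\<^sub>R d)))"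
    and B': "bounded_linear B'" "B' \<circ> B = id"
  shows "((\<lambda>t. d \<bullet> inv G (v + t *\<^sub>R d)) has_real_derivative d \<bullet> B' d) (at t)"
proof -
  have "((\<lambda>t. v + t *\<^sub>R d) has_derivative (\<lambda>s. s *\<^sub>R d)) (at t)"
    by (auto intro!: derivative_eq_intros)
  moreover have "(inv G has_derivative B') (at (v + t *\<^sub>R d))"
    by (rule has_derivative_inv_G[OF assms])
  ultimately have "((\<lambda>t. inv G (v + t *\<^sub>R d)) has_derivative (\<lambda>s. B' (s *\<^sub>R d))) (at t)"
    by (rule has_derivative_compose)
  then have "((\<lambda>t. d \<bullet> inv G (v + t *\<^sub>R d)) has_derivative (\<lambda>s. d \<bullet> B' (s *\<^sub>R d))) (at t)"
    by (rule has_derivative_inner_right)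
  moreover have "(\<lambda>s. d \<bullet> B' (s *\<^sub>R d)) = (*) (d \<bullet> B' d)"
    using linear_cmul[OF bounded_linear.linear[OF B'(1)]] by (auto simp: fun_eq_iff)
  ultimately show ?thesis unfolding has_field_derivative_def by simp
qed

text \<open>The difference of the conjugates of \<open>F\<close> and \<open>p\<close> has second derivative \<open>A\<inverse> - B\<inverse>\<close>, which is positive
semidefinite, on the convex set \<open>range dF\<close>.  Hence it lies above its tangents there.  Since
every \<open>F x\<close> equals \<open>u \<bullet> x\<close> minus the conjugate at \<open>u = dF x\<close>, this is enough for the model inequality.\<close>

lemma hessian_le_imp_descends:
  assumes F: "legendre_potential F dF" and sub: "range dF \<subseteq> range G"
    and A: "\<And>x. (dF has_derivative A x) (at x)" "\<And>x. bounded_linear (A' x)"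
      "\<And>x. A' x \<circ> A x = id" "\<And>x. A x \<circ> A' x = id"
    and B: "\<And>x. (G has_derivative B x) (at x)" "\<And>x. bounded_linear (B' x)"
      "\<And>x. B' x \<circ> B x = id" "\<And>x. B x \<circ> B' x = id"
    and le: "\<And>x v. v \<bullet> A x v \<le> v \<bullet> B (inv G (dF x)) v"
  shows "descends (\<lambda>x. ereal (F x))"
proof -
  interpret F: legendre_potential F dF by (rule F)
  have model: "F x \<le> F x0 + p (x - x0 + inv G (dF x0)) - p (inv G (dF x0))" for x x0
  proof -
    define u where "u = dF x"
    define v where "v = dF x0"
    define d where "d = u - v"
    define z where "z = inv G v"
    have xv: "inv dF u = x" "inv dF v = x0" by (simp_all add: u_def v_def F.inv_G)
    have rv: "u \<in> range G" "v \<in> range G" using sub by (auto simp: u_def v_def)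
    have seg: "v + t *\<^sub>R d \<in> range dF" if "0 \<le> t" "t \<le> 1" for t
    proof -
      have "convex (range dF)"
        unfolding F.interior_dom_pc[symmetric]
        by (intro convex_interior convex_dom_fun convex_fun_conjugate)
      then have "(1 - t) *\<^sub>R v + t *\<^sub>R u \<in> range dF"
        using that by (intro convexD_alt) (auto simp: u_def v_def)
      then show ?thesis by (simp add: d_def algebra_simps)
    qed
    define a where "a t = real_of_ereal (F.pc (v + t *\<^sub>R d)) - real_of_ereal (pc (v + t *\<^sub>R d))" for t
    define a' where "a' t = d \<bullet> inv dF (v + t *\<^sub>R d) - d \<bullet> inv G (v + t *\<^sub>R d)" for t
    have da: "(a has_real_derivative a' t) (at t)" if "0 \<le> t" "t \<le> 1" for t
      unfolding a_def a'_def using seg[OF that] sub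
      by (intro DERIV_diff F.pc_line_derivative pc_line_derivative) auto
    have da': "\<exists>y. (a' has_real_derivative y) (at t) \<and> 0 \<le> y" if "0 \<le> t" "t \<le> 1" for t
    proof -
      let ?w = "v + t *\<^sub>R d"
      let ?x = "inv dF ?w" and ?y = "inv G ?w"
      have w: "?w \<in> range dF" "?w \<in> range G" using seg[OF that] sub by auto
      have "(a' has_real_derivative (d \<bullet> A' ?x d - d \<bullet> B' ?y d)) (at t)"
        unfolding a'_def
        by (intro DERIV_diff F.inv_G_line_derivative[OF w(1) A(1) A(2) A(3)]
            inv_G_line_derivative[OF w(2) B(1) B(2) B(3)])
      moreover have "d \<bullet> B' ?y d \<le> d \<bullet> A' ?x d"
      proof (rule inverse_antimono_quadratic_form)
        show "linear (A ?x)" by (rule has_derivative_linear[OF A(1)])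
        show "v \<bullet> A ?x u = u \<bullet> A ?x v" for u v
          by (rule gradient_derivative_symmetric[OF F.grad_p A(1)])
        show "0 \<le> v \<bullet> A ?x v" for v
          by (rule convex_gradient_derivative_nonneg[OF F.convex_p F.grad_p A(1)])
        show "v \<bullet> A ?x v \<le> v \<bullet> B ?y v" for v using le[of v ?x] F.G_inv[OF w(1)] by simp
        show "A ?x (A' ?x d) = d" using A(4)[of ?x] by (metis comp_apply id_apply)
        show "B ?y (B' ?y d) = d" using B(4)[of ?y] by (metis comp_apply id_apply)
      qed
      ultimately show ?thesis by (intro exI[of _ "d \<bullet> A' ?x d - d \<bullet> B' ?y d"]) simp
    qed
    obtain t where t: "0 < t" "t < 1" "a 1 - a 0 = (1 - 0) * a' t"
      using MVT2[of 0 1 a a'] da by auto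
    have "a' 0 \<le> a' t"
      by (rule DERIV_nonneg_imp_nondecreasing) (use t da' in auto)
    then have "a 0 + a' 0 \<le> a 1" using t(3) by simp
    moreover have "a' 0 = (u - v) \<bullet> (x0 - z)"
      by (simp add: a'_def xv z_def d_def inner_diff_right)
    moreover have "a 0 = (v \<bullet> x0 - F x0) - (v \<bullet> z - p z)"
      using pc_G[of z] by (simp add: a_def z_def v_def F.pc_G G_inv rv(2)[unfolded v_def])
    moreover have "a 1 = (u \<bullet> x - F x) - real_of_ereal (pc u)"
      by (simp add: a_def d_def u_def F.pc_G)
    moreover have "u \<bullet> (x - x0 + z) - p (x - x0 + z) \<le> real_of_ereal (pc u)"
      using pc_ge[of u "x - x0 + z"] pc_G[of "inv G u"] G_inv[OF rv(1)] by simp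
    ultimately show ?thesis
      by (simp add: z_def[symmetric] v_def[symmetric] inner_diff_left inner_diff_right inner_add_right)
  qed
  note C1 = C1_funI[OF F.grad_p F.continuous_G]
  show ?thesis unfolding descends_def C1(2) using C1(1) sub model by auto
qed

end

section \<open>Reduction to the constant one\<close>

text \<open>If two points had the same gradient, the two tangents there would coincide on the segment between them, which
contradicts strict convexity at the midpoint.\<close>

lemma Legendre_fun_imp_potential:
  assumes "Legendre_fun \<phi>" and "dom_fun \<phi> = UNIV"
  obtains P where "\<phi> = (\<lambda>x. ereal (P x))" "legendre_potential P (grad \<phi>)"
proof -
  define P where "P x = real_of_ereal (\<phi> x)" for x
  have G0: "\<phi> \<in> Gamma0" using assms by (simp add: Legendre_fun_def)
  have P: "\<phi> = (\<lambda>x. ereal (P x))"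
  proof
    fix x
    have "\<phi> x < \<infinity>" using assms(2) by (auto simp: dom_fun_def)
    moreover have "\<phi> x \<noteq> -\<infinity>" using G0 by (simp add: Gamma0_def proper_fun_def)
    ultimately show "\<phi> x = ereal (P x)" unfolding P_def by (cases "\<phi> x") auto
  qed
  have cv: "convex_on UNIV P" using G0 unfolding Gamma0_def P by (simp add: convex_fun_real_iff)
  have g: "GDERIV P x :> grad \<phi> x" for x
  proof -
    have "\<exists>g. has_gradient \<phi> g x"
      using assms by (simp add: Legendre_fun_def essentially_smooth_def)
    then obtain g where g: "has_gradient \<phi> g x" ..
    then have "grad \<phi> x = g" by (rule grad_eqI)
    then show ?thesis using g unfolding P by (simp add: has_gradient_real_iff)
  qed
  have sub: "grad \<phi> x \<in> subdifferential \<phi> x" for x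
    using convex_gradient_inequality[OF cv g, of x] by (simp add: subdifferential_def P)
  then have "UNIV \<subseteq> {x. subdifferential \<phi> x \<noteq> {}}" by blast
  then have strict: "strictly_convex_on UNIV \<phi>"
    using assms by (simp add: Legendre_fun_def essentially_strictly_convex_def)
  have "inj (grad \<phi>)"
  proof (rule injI, rule ccontr)
    fix x y assume eq: "grad \<phi> x = grad \<phi> y" and "x \<noteq> y"
    let ?m = "(1 - 1/2) *\<^sub>R x + (1/2) *\<^sub>R y"
    have "\<phi> ?m < ereal (1 - 1/2) * \<phi> x + ereal (1/2) * \<phi> y"
      by (rule strict[unfolded strictly_convex_on_def, rule_format]) (use \<open>x \<noteq> y\<close> in auto)
    then have "P ?m < (1/2) * P x + (1/2) * P y" by (simp add: P)
    moreover have "P x + grad \<phi> x \<bullet> (?m - x) \<le> P ?m" "P y + grad \<phi> x \<bullet> (?m - y) \<le> P ?m"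
      using convex_gradient_inequality[OF cv g, of x ?m] convex_gradient_inequality[OF cv g, of y ?m] eq
      by simp_all
    moreover have "grad \<phi> x \<bullet> (?m - x) + grad \<phi> x \<bullet> (?m - y) = 0"
      unfolding inner_add_right[symmetric] by (simp add: algebra_simps flip: scaleR_add_left)
    ultimately show False by linarith
  qed
  then have "legendre_potential P (grad \<phi>)" using cv g by unfold_locales auto
  then show ?thesis using that P by blast
qed

lemma ereal_eq_if_same_real_bounds:
  fixes a b :: ereal
  assumes "\<And>c. a \<le> ereal c \<longleftrightarrow> b \<le> ereal c"
  shows "a = b"
proof (rule antisym)
  show "a \<le> b" by (rule ereal_le_real) (rule assms[THEN iffD2])
  show "b \<le> a" by (rule ereal_le_real) (rule assms[THEN iffD1])
qed

text \<open>Epi-scaling the reference function by \<open>1 / L\<close> absorbs the constant: the range of the gradient does not change, while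
the conjugate and its gradient are divided by \<open>L\<close>.\<close>

lemma (in legendre_potential) epi_scale_potential:
  assumes L: "L > 0"
  defines "q \<equiv> \<lambda>x. p (L *\<^sub>R x) / L"
  shows "epi_scale (1 / L) pE = (\<lambda>x. ereal (q x))"
    and "legendre_potential q (\<lambda>x. G (L *\<^sub>R x))"
    and "conjugate (\<lambda>x. ereal (q x)) = (\<lambda>v. ereal (1 / L) * pc v)"
    and "range (\<lambda>x. G (L *\<^sub>R x)) = range G"
    and "\<And>v. v \<in> range G \<Longrightarrow> inv (\<lambda>x. G (L *\<^sub>R x)) v = (1 / L) *\<^sub>R inv G v"
proof -
  show "epi_scale (1 / L) pE = (\<lambda>x. ereal (q x))"
    by (simp add: epi_scale_def q_def fun_eq_iff)
  have surj: "G v = G (L *\<^sub>R ((1 / L) *\<^sub>R v))" for v using L by simp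
  then show rng: "range (\<lambda>x. G (L *\<^sub>R x)) = range G" 
    by (auto intro: range_eqI[where f="\<lambda>x. G (L *\<^sub>R x)", OF surj])
  have inj: "inj (\<lambda>x. G (L *\<^sub>R x))"
    using L by (auto intro!: injI dest!: injD[OF inj_G])
  show "legendre_potential q (\<lambda>x. G (L *\<^sub>R x))"
  proof
    show "convex_on UNIV q"
    proof (rule convex_onI)
      fix t :: real and x y :: 'a assume "0 < t" "t < 1"
      then have "p ((1 - t) *\<^sub>R (L *\<^sub>R x) + t *\<^sub>R (L *\<^sub>R y)) \<le> (1 - t) * p (L *\<^sub>R x) + t * p (L *\<^sub>R y)"
        by (intro convex_onD[OF convex_p]) auto
      then show "q ((1 - t) *\<^sub>R x + t *\<^sub>R y) \<le> (1 - t) * q x + t * q y"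
        using L by (simp add: q_def field_simps)
    qed simp
    fix x
    have "GDERIV (\<lambda>x. p (L *\<^sub>R x + 0)) x :> L *\<^sub>R G (L *\<^sub>R x)"
      by (rule GDERIV_affine) (simp add: grad_p)
    then have "((\<lambda>x. p (L *\<^sub>R x)) has_derivative (\<lambda>h. h \<bullet> (L *\<^sub>R G (L *\<^sub>R x)))) (at x)"
      by (simp add: gderiv_def)
    then have "((\<lambda>x. (1 / L) * p (L *\<^sub>R x)) has_derivative (\<lambda>h. (1 / L) * (h \<bullet> (L *\<^sub>R G (L *\<^sub>R x))))) (at x)"
      by (rule has_derivative_mult_right)
    then show "GDERIV q x :> G (L *\<^sub>R x)" using L by (simp add: gderiv_def q_def)
  qed (rule inj)
  show "conjugate (\<lambda>x. ereal (q x)) = (\<lambda>v. ereal (1 / L) * pc v)"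
  proof (rule ext, rule ereal_eq_if_same_real_bounds)
    fix v c
    have "ereal (1 / L) * pc v \<le> ereal c \<longleftrightarrow> pc v \<le> ereal (L * c)"
      using L by (cases "pc v") (auto simp: field_simps)
    also have "\<dots> \<longleftrightarrow> (\<forall>x. v \<bullet> (L *\<^sub>R x) - L * c \<le> p (L *\<^sub>R x))"
    proof -
      have "(\<forall>x. v \<bullet> x - L * c \<le> p x) \<longleftrightarrow> (\<forall>x. v \<bullet> (L *\<^sub>R x) - L * c \<le> p (L *\<^sub>R x))"
      proof safe
        fix x assume "\<forall>x. v \<bullet> (L *\<^sub>R x) - L * c \<le> p (L *\<^sub>R x)"
        from this[rule_format, of "(1 / L) *\<^sub>R x"] show "v \<bullet> x - L * c \<le> p x" using L by simp
      next
        fix x assume "\<forall>x. v \<bullet> x - L * c \<le> p x"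
        then show "v \<bullet> (L *\<^sub>R x) - L * c \<le> p (L *\<^sub>R x)" by blast
      qed
      then show ?thesis by (simp add: conjugate_le_iff)
    qed
    also have "\<dots> \<longleftrightarrow> conjugate (\<lambda>x. ereal (q x)) v \<le> ereal c"
      using L by (simp add: conjugate_le_iff q_def field_simps)
    finally show "conjugate (\<lambda>x. ereal (q x)) v \<le> ereal c \<longleftrightarrow> ereal (1 / L) * pc v \<le> ereal c" by simp
  qed
  fix v assume "v \<in> range G"
  then have "G (L *\<^sub>R ((1 / L) *\<^sub>R inv G v)) = v" using surj G_inv by simp
  then show "inv (\<lambda>x. G (L *\<^sub>R x)) v = (1 / L) *\<^sub>R inv G v" using inj by (metis inv_f_eq)
qed

lemma C2_fun_grad_derivative:
  assumes "C2_fun h"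
  shows "(grad h has_derivative (\<lambda>v. hessian h x *v v)) (at x)"
  using assms unfolding C2_fun_def hessian_def by (metis jacobian_works)

theorem proposition4p1:
  fixes f \<phi> :: "real ^ 'n \<Rightarrow> ereal" and L :: real
  assumes "Legendre_fun \<phi>" and "dom_fun \<phi> = UNIV"
    and "proper_fun f" and "lsc_fun f" and "L > 0"
  shows
    "(anisotropic_descent \<phi> L f \<longleftrightarrow>
        C1_fun f \<and> range (grad f) \<subseteq> range (grad \<phi>) \<and>
        (\<exists>\<xi>. f = inf_conv \<xi> (epi_scale (1 / L) \<phi>)))
     \<and>
     (anisotropic_descent \<phi> L f \<or>
        (C1_fun f \<and> range (grad f) \<subseteq> range (grad \<phi>) \<and>
         (\<exists>\<xi>. f = inf_conv \<xi> (epi_scale (1 / L) \<phi>))) \<longrightarrow>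
      (\<exists>\<xi>. proper_fun \<xi> \<and> lsc_fun \<xi> \<and> f = inf_conv \<xi> (epi_scale (1 / L) \<phi>) \<and>
           exact_inf_conv \<xi> (epi_scale (1 / L) \<phi>)))
     \<and>
     (convex_fun f \<longrightarrow>
       (anisotropic_descent \<phi> L f \<longleftrightarrow>
          (\<Union>x. subdifferential f x) \<subseteq> range (grad \<phi>) \<and>
          (\<exists>\<xi>. f = inf_conv \<xi> (epi_scale (1 / L) \<phi>)))
       \<and>
       (anisotropic_descent \<phi> L f \<longrightarrow>
          (\<exists>\<xi>. proper_fun \<xi> \<and> lsc_fun \<xi> \<and> convex_fun \<xi> \<and>
               f = inf_conv \<xi> (epi_scale (1 / L) \<phi>) \<and>
               exact_inf_conv \<xi> (epi_scale (1 / L) \<phi>)))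
       \<and>
       (anisotropic_descent \<phi> L f \<longleftrightarrow>
          (\<exists>\<psi>\<in>Gamma0.
             conjugate f = (\<lambda>v. \<psi> v + ereal (1 / L) * conjugate \<phi> v) \<and>
             dom_fun \<psi> \<inter> interior (dom_fun (conjugate \<phi>)) \<noteq> {}))
       \<and>
       (anisotropic_descent \<phi> L f \<longleftrightarrow>
          dom_fun (conjugate f) \<subseteq> dom_fun (conjugate \<phi>) \<and>
          rel_interior (dom_fun (conjugate f)) \<inter> interior (dom_fun (conjugate \<phi>)) \<noteq> {} \<and>
          convex_on (rel_interior (dom_fun (conjugate f)))
            (\<lambda>v. real_of_ereal (conjugate f v - ereal (1 / L) * conjugate \<phi> v)))
       \<and>
       (Legendre_fun f \<and> C2_fun f \<and> C2_fun \<phi> \<and>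
        (\<forall>x. invertible (hessian f x)) \<and> (\<forall>x. invertible (hessian \<phi> x)) \<longrightarrow>
        (anisotropic_descent \<phi> L f \<longleftrightarrow>
           range (grad f) \<subseteq> range (grad \<phi>) \<and>
           (\<forall>x. loewner_le (hessian f x)
                  (L *\<^sub>R hessian \<phi> (grad (conjugate \<phi>) (grad f x)))))))"
proof -
  obtain P where P: "\<phi> = (\<lambda>x. ereal (P x))" and lp: "legendre_potential P (grad \<phi>)"
    using Legendre_fun_imp_potential[OF assms(1,2)] by blast
  note L = \<open>L > 0\<close>
  interpret P: legendre_potential P "grad \<phi>" by (rule lp)
  define q where "q x = P (L *\<^sub>R x) / L" for x
  define Gq where "Gq x = grad \<phi> (L *\<^sub>R x)" for x
  note sc = P.epi_scale_potential[OF L, folded q_def Gq_def P]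
  interpret q: legendre_potential q Gq using sc(2) by (simp add: Gq_def[abs_def])
  have es: "epi_scale (1 / L) \<phi> = q.pE" using sc(1) .
  have pc: "q.pc = (\<lambda>v. ereal (1 / L) * conjugate \<phi> v)" using sc(3) .
  have rng: "range Gq = range (grad \<phi>)" using sc(4) by (simp add: Gq_def[abs_def])
  have invG: "(1 / L) *\<^sub>R grad (conjugate \<phi>) v = inv Gq v" if "v \<in> range (grad \<phi>)" for v
    using sc(5)[OF that] P.grad_pc[OF that] by (simp add: Gq_def[abs_def] flip: P)
  have dom: "dom_fun q.pc = dom_fun (conjugate \<phi>)"
    unfolding pc dom_fun_def
  proof (rule Collect_cong)
    fix v show "ereal (1 / L) * conjugate \<phi> v < \<infinity> \<longleftrightarrow> conjugate \<phi> v < \<infinity>"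
      using L by (cases "conjugate \<phi> v") auto
  qed
  have desc: "anisotropic_descent \<phi> L f \<longleftrightarrow> q.descends f"
  proof (cases "range (grad f) \<subseteq> range (grad \<phi>)")
    case True
    then have "(1 / L) *\<^sub>R grad (conjugate \<phi>) (grad f x) = inv Gq (grad f x)" for x
      by (intro invG) auto
    then show ?thesis unfolding anisotropic_descent_def q.descends_def es rng by simp
  qed (simp add: anisotropic_descent_def q.descends_def rng)
  have ii: "q.descends f \<longleftrightarrow> C1_fun f \<and> range (grad f) \<subseteq> range (grad \<phi>) \<and> (\<exists>\<xi>. f = inf_conv \<xi> q.pE)"
    using q.descends_iff_inf_conv[of f] unfolding rng .
  have exact: "\<exists>\<xi>. proper_fun \<xi> \<and> lsc_fun \<xi> \<and> f = inf_conv \<xi> q.pE \<and> exact_inf_conv \<xi> q.pE \<and>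
      (convex_fun f \<longrightarrow> convex_fun \<xi>)" if "q.descends f"
    using q.descends_exact_inf_conv[OF that] by metis
  have iii: "\<exists>\<psi>\<in>Gamma0. conjugate f = (\<lambda>v. \<psi> v + q.pc v) \<and> dom_fun \<psi> \<inter> interior (dom_fun q.pc) \<noteq> {}"
    if "convex_fun f" "q.descends f"
    by (rule q.descends_imp_conjugate_decomposition[OF that(2,1)])
  have iv: "dom_fun (conjugate f) \<subseteq> dom_fun q.pc \<and>
      rel_interior (dom_fun (conjugate f)) \<inter> interior (dom_fun q.pc) \<noteq> {} \<and>
      convex_on (rel_interior (dom_fun (conjugate f))) (\<lambda>v. real_of_ereal (conjugate f v - q.pc v))"
    if "\<exists>\<psi>\<in>Gamma0. conjugate f = (\<lambda>v. \<psi> v + q.pc v) \<and> dom_fun \<psi> \<inter> interior (dom_fun q.pc) \<noteq> {}"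
    using that q.conjugate_decomposition_imp_convex_difference by blast
  have iv_i: "q.descends f" if "convex_fun f" "dom_fun (conjugate f) \<subseteq> dom_fun q.pc \<and>
      rel_interior (dom_fun (conjugate f)) \<inter> interior (dom_fun q.pc) \<noteq> {} \<and>
      convex_on (rel_interior (dom_fun (conjugate f))) (\<lambda>v. real_of_ereal (conjugate f v - q.pc v))"
    using that assms(3,4) by (intro q.convex_difference_imp_descends) (auto simp: Gamma0_def)
  have v: "q.descends f \<longleftrightarrow> range (grad f) \<subseteq> range (grad \<phi>) \<and>
      (\<forall>x. loewner_le (hessian f x) (L *\<^sub>R hessian \<phi> (grad (conjugate \<phi>) (grad f x))))"
    if f: "Legendre_fun f" and C2: "C2_fun f" "C2_fun \<phi>"
      and inv: "\<forall>x. invertible (hessian f x)" "\<forall>x. invertible (hessian \<phi> x)"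
  proof -
    have "C1_fun f" using C2 by (simp add: C2_fun_def)
    then have "dom_fun f = UNIV" by (rule C1_funE) (auto simp: dom_fun_def)
    with f obtain F where F: "f = (\<lambda>x. ereal (F x))" and lF: "legendre_potential F (grad f)"
      using Legendre_fun_imp_potential by blast
    interpret F: legendre_potential F "grad f" by (rule lF)
    let ?A = "hessian f" and ?B = "\<lambda>x. L *\<^sub>R hessian \<phi> (L *\<^sub>R x)"
    have A: "(grad f has_derivative (*v) (?A x)) (at x)" for x
      by (rule C2_fun_grad_derivative[OF C2(1)])
    have B: "(Gq has_derivative (*v) (?B x)) (at x)" for x
    proof -
      have "((\<lambda>x. L *\<^sub>R x) has_derivative (\<lambda>h. L *\<^sub>R h)) (at x)"
        by (auto intro!: derivative_eq_intros)
      then have "(Gq has_derivative (\<lambda>h. hessian \<phi> (L *\<^sub>R x) *v (L *\<^sub>R h))) (at x)"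
        unfolding Gq_def[abs_def]
        by (rule has_derivative_compose) (rule C2_fun_grad_derivative[OF C2(2)])
      then show ?thesis
        by (simp add: matrix_vector_mult_scaleR scaleR_matrix_vector_assoc)
    qed
    have invB: "invertible (?B x)" for x
      using inv(2) L by (simp add: scalar_invertible)
    have loe: "loewner_le (?A x) (L *\<^sub>R hessian \<phi> (grad (conjugate \<phi>) (grad f x))) \<longleftrightarrow>
        (\<forall>v. v \<bullet> (?A x *v v) \<le> v \<bullet> (?B (inv Gq (grad f x)) *v v))"
      if "range (grad f) \<subseteq> range (grad \<phi>)" for x
    proof -
      have "L *\<^sub>R inv Gq (grad f x) = grad (conjugate \<phi>) (grad f x)"
        using invG[of "grad f x", symmetric] that L by (simp add: subset_iff)
      then show ?thesis
        by (simp add: loewner_le_def matrix_vector_mult_diff_rdistrib inner_diff_right)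
    qed
    have mi: "bounded_linear ((*v) (matrix_inv M))" "(*v) (matrix_inv M) \<circ> (*v) M = id"
      "(*v) M \<circ> (*v) (matrix_inv M) = id" if "invertible M" for M :: "real^'n^'n"
    proof -
      have "M ** matrix_inv M = mat 1 \<and> matrix_inv M ** M = mat 1"
        unfolding matrix_inv_def using that[unfolded invertible_def] by (rule someI_ex)
      then show "bounded_linear ((*v) (matrix_inv M))" "(*v) (matrix_inv M) \<circ> (*v) M = id"
        "(*v) M \<circ> (*v) (matrix_inv M) = id"
        by (auto simp: fun_eq_iff matrix_vector_mul_assoc matrix_vector_mul_bounded_linear)
    qed
    show ?thesis
    proof
      assume d: "q.descends f"
      then have r: "range (grad f) \<subseteq> range (grad \<phi>)" using ii by blast
      have "v \<bullet> (?A x *v v) \<le> v \<bullet> (?B (inv Gq (grad f x)) *v v)" for x v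
        by (rule q.descends_hessian_le[OF d[unfolded F] F.grad_p A B])
      then show "range (grad f) \<subseteq> range (grad \<phi>) \<and>
          (\<forall>x. loewner_le (?A x) (L *\<^sub>R hessian \<phi> (grad (conjugate \<phi>) (grad f x))))"
        using r loe[OF r] by blast
    next
      assume *: "range (grad f) \<subseteq> range (grad \<phi>) \<and>
          (\<forall>x. loewner_le (?A x) (L *\<^sub>R hessian \<phi> (grad (conjugate \<phi>) (grad f x))))"
      then have r: "range (grad f) \<subseteq> range Gq" unfolding rng by blast
      have "q.descends (\<lambda>x. ereal (F x))"
        by (rule q.hessian_le_imp_descends[OF lF r A mi(1) mi(2) mi(3) B mi(1) mi(2) mi(3)])
          (use inv(1) invB * loe in auto)
      then show "q.descends f" by (simp add: F)
    qed
  qed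
  have pcv: "ereal (1 / L) * conjugate \<phi> v = q.pc v" for v by (simp add: pc)
  show ?thesis
    unfolding desc es dom[symmetric] pcv
  proof (intro conjI impI, goal_cases)
    case 1
    show ?case by (rule ii)
  next
    case 2
    then have "q.descends f" using ii by blast
    then show ?case using exact by blast
  next
    case 3
    show ?case using q.convex_descends_iff_inf_conv[OF assms(3) 3] unfolding rng .
  next
    case 4
    show ?case using exact[OF 4(2)] 4(1) by blast
  next
    case 5
    show ?case by (rule iffI[OF iii[OF 5] iv_i[OF 5 iv]])
  next
    case 6
    show ?case by (rule iffI[OF iv[OF iii[OF 6]] iv_i[OF 6]])
  next
    case 7
    then show ?case by (intro v) auto
  qed
qed

end
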